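(* If $p\in\mathbb{R}[x_1,\dots,x_n]$ is a symmetric hyperbolic polynomial of degree $3$, then the hyperbolicity cone $H_{\vec 1}(p)$ is spectrahedral.
   Context: $\vec 1=(1,\dots,1)\in\mathbb{R}^n$. A homogeneous $p\in\mathbb{R}[x_1,\dots,x_n]$ is hyperbolic with respect to $v\in\mathbb{R}^n$ if $p(v)\ne0$ and for every $x\in\mathbb{R}^n$ the univariate polynomial $p(x+tv)$ in $t$ has only real roots. $p$ is symmetric hyperbolic if it is invariant under all permutations of the variables and hyperbolic with respect to $\vec 1$. The hyperbolicity cone is $H_v(p)=\{x\in\mathbb{R}^n: p(x+tv)\ne0\text{ for all }t>0\}$; it is spectrahedral if for some $m\in\mathbb{N}$ there are real symmetric $m\times m$ matrices $A_1,\dots,A_n$ with $H_v(p)=\{x\in\mathbb{R}^n:\sum_{i=1}^nA_ix_i\succeq0\}$. *)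

theory Defs
  imports
    "HOL-Analysis.Analysis"
    "HOL-Library.Poly_Mapping"
    "HOL-Computational_Algebra.Polynomial"
    "HOL-Combinatorics.Permutations"
    "Jordan_Normal_Form.Matrix"
begin

no_notation Matrix.vec_index (infixl "$" 100)
no_notation Matrix.scalar_prod (infix "\<bullet>" 70)

text \<open>
  The polynomial ring in finitely many variables \<open>x\<^sub>i\<close>, with \<open>i\<close> ranging over the finite
  type \<open>'n\<close>, is the monoid algebra of the exponent vectors \<open>'n \<Rightarrow>\<^sub>0 nat\<close>; its ring
  operations are those of the instantiations in \<^theory>\<open>HOL-Library.Poly_Mapping\<close>.
\<close>

type_synonym ('n, 'a) mpoly = "('n \<Rightarrow>\<^sub>0 nat) \<Rightarrow>\<^sub>0 'a"

definition monom_degree :: "('n::finite \<Rightarrow>\<^sub>0 nat) \<Rightarrow> nat" where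
  "monom_degree m = (\<Sum>i\<in>UNIV. Poly_Mapping.lookup m i)"

text \<open>The total degree; the zero polynomial gets degree \<open>0\<close>.\<close>

definition total_degree :: "('n::finite, 'a::zero) mpoly \<Rightarrow> nat" where
  "total_degree p = Max (insert 0 (monom_degree ` Poly_Mapping.keys p))"

definition homogeneous :: "('n::finite, 'a::zero) mpoly \<Rightarrow> bool" where
  "homogeneous p \<longleftrightarrow> (\<forall>m\<in>Poly_Mapping.keys p. monom_degree m = total_degree p)"

text \<open>
  Substitution of elements \<open>f i\<close> of a commutative ring \<open>'b\<close> for the variables, where
  \<open>h\<close> is the embedding of the coefficients into \<open>'b\<close>.
\<close>

definition subst_vars ::
  "('a::zero \<Rightarrow> 'b::comm_semiring_1) \<Rightarrow> ('n::finite \<Rightarrow> 'b) \<Rightarrow> ('n, 'a) mpoly \<Rightarrow> 'b" where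
  "subst_vars h f p =
     (\<Sum>m\<in>Poly_Mapping.keys p. h (Poly_Mapping.lookup p m) *
        (\<Prod>i\<in>UNIV. f i ^ Poly_Mapping.lookup m i))"

definition mpoly_eval :: "('n::finite, real) mpoly \<Rightarrow> real ^ 'n \<Rightarrow> real" where
  "mpoly_eval p x = subst_vars (\<lambda>c. c) (\<lambda>i. x $ i) p"

text \<open>The univariate polynomial \<open>p(x + t v)\<close> in the indeterminate \<open>t\<close>.\<close>

definition line_poly :: "('n::finite, real) mpoly \<Rightarrow> real ^ 'n \<Rightarrow> real ^ 'n \<Rightarrow> real poly" where
  "line_poly p x v = subst_vars (\<lambda>c. [:c:]) (\<lambda>i. [:x $ i, v $ i:]) p"

lemma poly_line_poly: "poly (line_poly p x v) t = mpoly_eval p (x + t *\<^sub>R v)"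
  by (simp add: line_poly_def mpoly_eval_def subst_vars_def poly_sum poly_prod)

definition only_real_roots :: "real poly \<Rightarrow> bool" where
  "only_real_roots q \<longleftrightarrow> (\<forall>z::complex. poly (map_poly of_real q) z = 0 \<longrightarrow> z \<in> \<real>)"

definition hyperbolic :: "('n::finite, real) mpoly \<Rightarrow> real ^ 'n \<Rightarrow> bool" where
  "hyperbolic p v \<longleftrightarrow>
     homogeneous p \<and> mpoly_eval p v \<noteq> 0 \<and> (\<forall>x. only_real_roots (line_poly p x v))"

text \<open>
  \<open>permute_vars \<pi> p\<close> is the polynomial obtained from \<open>p\<close> by replacing every \<open>x\<^sub>i\<close> by
  \<open>x\<^bsub>\<pi> i\<^esub>\<close>. Since \<open>Poly_Mapping.map_key\<close> is precomposition, the coefficient of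
  the result at the exponent vector \<open>m\<close> is that of \<open>p\<close> at \<open>m \<circ> \<pi>\<close>. The definition is
  meaningful only for bijective \<open>\<pi>\<close>.
\<close>

definition permute_vars :: "('n \<Rightarrow> 'n) \<Rightarrow> ('n, 'a::zero) mpoly \<Rightarrow> ('n, 'a) mpoly" where
  "permute_vars \<pi> p = Poly_Mapping.map_key (Poly_Mapping.map_key \<pi>) p"

lemma inj_map_key:
  assumes "bij \<pi>"
  shows "inj (Poly_Mapping.map_key \<pi> :: ('n \<Rightarrow>\<^sub>0 'a::zero) \<Rightarrow> _)"
proof (rule injI)
  fix m m' :: "'n \<Rightarrow>\<^sub>0 'a"
  assume "Poly_Mapping.map_key \<pi> m = Poly_Mapping.map_key \<pi> m'"
  then have "Poly_Mapping.lookup m \<circ> \<pi> = Poly_Mapping.lookup m' \<circ> \<pi>"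
    using assms by (metis bij_is_inj map_key.rep_eq)
  then have "Poly_Mapping.lookup m = Poly_Mapping.lookup m'"
    using assms by (metis bij_is_surj surj_fun_eq o_apply ext)
  then show "m = m'"
    by (simp add: Poly_Mapping.lookup_inject)
qed

lemma lookup_permute_vars:
  assumes "bij \<pi>"
  shows "Poly_Mapping.lookup (permute_vars \<pi> p) m =
         Poly_Mapping.lookup p (Poly_Mapping.map_key \<pi> m)"
  unfolding permute_vars_def by (simp add: map_key.rep_eq[OF inj_map_key[OF assms]])

lemma subst_vars_permute_vars:
  assumes "bij \<pi>"
  shows "subst_vars h f (permute_vars \<pi> p) = subst_vars h (\<lambda>i. f (\<pi> i)) p"
proof -
  let ?k = "Poly_Mapping.map_key \<pi> :: ('a \<Rightarrow>\<^sub>0 nat) \<Rightarrow> _"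
  have inj: "inj ?k" using inj_map_key[OF assms] .
  have "bij (inv_into UNIV \<pi>)" using assms by (rule bij_imp_bij_inv)
  have "?k (Poly_Mapping.map_key (inv_into UNIV \<pi>) m) = m" for m
    by (rule poly_mapping_eqI)
       (simp add: map_key.rep_eq bij_is_inj assms \<open>bij (inv_into UNIV \<pi>)\<close>)
  then have surj: "surj ?k" by (metis surjI)
  have keys: "Poly_Mapping.keys p = ?k ` Poly_Mapping.keys (permute_vars \<pi> p)"
    unfolding permute_vars_def keys_map_key[OF inj] using surj by (simp add: surj_image_vimage_eq)
  have "(\<Prod>i\<in>UNIV. f (\<pi> i) ^ Poly_Mapping.lookup (?k m) i) =
        (\<Prod>i\<in>UNIV. f i ^ Poly_Mapping.lookup m i)" for m
    using prod.reindex_bij_betw[OF assms, of "\<lambda>i. f i ^ Poly_Mapping.lookup m i"]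
    by (simp add: map_key.rep_eq bij_is_inj assms)
  then show ?thesis
    unfolding subst_vars_def keys
    by (simp add: sum.reindex inj_on_subset[OF inj] lookup_permute_vars[OF assms])
qed

definition symmetric_mpoly :: "('n::finite, 'a::zero) mpoly \<Rightarrow> bool" where
  "symmetric_mpoly p \<longleftrightarrow> (\<forall>\<pi>. \<pi> permutes UNIV \<longrightarrow> permute_vars \<pi> p = p)"

definition all_ones :: "real ^ 'n" where
  "all_ones = (\<chi> i. 1)"

definition symmetric_hyperbolic :: "('n::finite, real) mpoly \<Rightarrow> bool" where
  "symmetric_hyperbolic p \<longleftrightarrow> symmetric_mpoly p \<and> hyperbolic p all_ones"

definition hyperbolicity_cone :: "('n::finite, real) mpoly \<Rightarrow> real ^ 'n \<Rightarrow> (real ^ 'n) set" where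
  "hyperbolicity_cone p v = {x. \<forall>t>0. mpoly_eval p (x + t *\<^sub>R v) \<noteq> 0}"

definition symmetric_real_mat :: "nat \<Rightarrow> real mat \<Rightarrow> bool" where
  "symmetric_real_mat m A \<longleftrightarrow> A \<in> carrier_mat m m \<and> A\<^sup>T = A"

definition psd_mat :: "nat \<Rightarrow> real mat \<Rightarrow> bool" where
  "psd_mat m A \<longleftrightarrow> symmetric_real_mat m A \<and>
     (\<forall>u\<in>carrier_vec m. scalar_prod u (A *\<^sub>v u) \<ge> 0)"

text \<open>
  The sum \<open>\<Sum>\<^sub>i x\<^sub>i A\<^sub>i\<close> of \<open>m \<times> m\<close> matrices, written entrywise because the type of
  matrices of all sizes has no zero element.
\<close>

definition linear_pencil :: "nat \<Rightarrow> ('n::finite \<Rightarrow> real mat) \<Rightarrow> real ^ 'n \<Rightarrow> real mat" where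
  "linear_pencil m A x = mat m m (\<lambda>(r, s). \<Sum>i\<in>UNIV. x $ i * (A i $$ (r, s)))"

text \<open>
  The matrix size \<open>m\<close> is quantified inside the formula, so the matrices are those of
  \<^theory>\<open>Jordan_Normal_Form.Matrix\<close>, whose size is not part of the type.
\<close>

definition spectrahedral :: "(real ^ 'n::finite) set \<Rightarrow> bool" where
  "spectrahedral C \<longleftrightarrow>
     (\<exists>m. \<exists>A :: 'n \<Rightarrow> real mat.
        (\<forall>i. symmetric_real_mat m (A i)) \<and> C = {x. psd_mat m (linear_pencil m A x)})"

end

theory Submission
  imports Defs "HOL-Computational_Algebra.Fundamental_Theorem_Algebra"
begin

text \<open>
  Write \<open>x = s\<cdot>1 + y\<close> with \<open>s\<close> the mean of \<open>x\<close>, \<open>q = \<Sum>y\<^sub>i^2\<close>, \<open>r = \<Sum>y\<^sub>i^3\<close>. A symmetric cubic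
  is \<open>A (s^3 + B s q + C r)\<close>, and the discriminant at \<open>y = (n-1,-1,\<dots>,-1)\<close> bounds
  \<open>C^2\<close> by a multiple of \<open>(-B)^3\<close>, with equality for the elementary symmetric polynomial \<open>e\<^sub>3\<close>.
  Evaluating \<open>e\<^sub>3\<close> in \<open>2n+1\<close> variables at the linear forms \<open>s + k y\<^sub>i\<close>, \<open>v (s - k y\<^sub>i)\<close>, \<open>v s\<close>
  interpolates between this extreme case (\<open>v = 0\<close>) and \<open>C = 0\<close> (\<open>v = 1\<close>), so by the intermediate
  value theorem every symmetric hyperbolic cubic is a multiple of a linear pullback of \<open>e\<^sub>3\<close>.

  The cone of \<open>e\<^sub>3\<close> is spectrahedral because \<open>3 e\<^sub>3 / e\<^sub>2\<close> is the effective conductance of a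
  series-parallel network with linear conductances: it is the parallel connection over \<open>i\<close> of
  \<open>z\<^sub>i\<close> in series with \<open>e\<^sub>2(z without z\<^sub>i) / e\<^sub>1(z without z\<^sub>i)\<close>, which is itself a parallel
  connection of such series. The energy form of the network is the required matrix pencil.
\<close>

section \<open>A bilinear form linear in a parameter defines a spectrahedron\<close>

lemma linear_vec_sum_axis:
  fixes g :: "real ^ 'k::finite \<Rightarrow> real"
  assumes "linear g"
  shows "g x = (\<Sum>i\<in>UNIV. x $ i * g (axis i 1))"
proof -
  have "x = (\<Sum>i\<in>UNIV. x $ i *\<^sub>R axis i 1)"
    using basis_expansion[of x] by (simp add: scalar_mult_eq_scaleR)
  then have "g x = g (\<Sum>i\<in>UNIV. x $ i *\<^sub>R axis i 1)"
    by simp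
  also have "\<dots> = (\<Sum>i\<in>UNIV. x $ i * g (axis i 1))"
    by (simp add: linear_sum[OF assms] linear_scale[OF assms])
  finally show ?thesis .
qed

text \<open>This moves all later work to forms on \<open>real ^ 'k\<close>: the enumeration
  \<open>b\<close> of \<open>'k\<close> is used only here, to reach matrices indexed by naturals.
  The coefficient matrices are the Gram matrices of \<open>B (axis i 1)\<close> in the standard
  basis.\<close>

lemma spectrahedral_bilinear:
  fixes B :: "real ^ 'n::finite \<Rightarrow> real ^ 'k::finite \<Rightarrow> real ^ 'k \<Rightarrow> real"
  assumes lin: "\<And>u v. linear (\<lambda>x. B x u v)" "\<And>x v. linear (\<lambda>u. B x u v)"
    and sym: "\<And>x u v. B x u v = B x v u"
  shows "spectrahedral {x. \<forall>u. 0 \<le> B x u u}"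
proof -
  define m where "m = CARD('k)"
  obtain b where b: "bij_betw b {0..<m} (UNIV :: 'k set)"
    using ex_bij_betw_nat_finite[of "UNIV :: 'k set"] m_def by auto
  define e where "e r = axis (b r) (1::real)" for r
  define A where "A i = mat m m (\<lambda>(r, s). B (axis i 1) (e r) (e s))" for i
  have lin2: "linear (\<lambda>v. B x u v)" for x u
    using lin(2)[of x u] sym by simp
  have pencil: "linear_pencil m A x = mat m m (\<lambda>(r, s). B x (e r) (e s))" for x
    unfolding linear_pencil_def
    by (intro cong_mat refl) (simp add: A_def linear_vec_sum_axis[OF lin(1), of x])
  have A: "symmetric_real_mat m (A i)" for i
    unfolding symmetric_real_mat_def A_def by (auto simp: sym intro!: eq_matI)
  have P: "symmetric_real_mat m (linear_pencil m A x)" for x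
    unfolding symmetric_real_mat_def pencil by (auto simp: sym intro!: eq_matI)
  have expand: "B x w w = (\<Sum>r = 0..<m. \<Sum>s = 0..<m. w $ b r * (w $ b s * B x (e r) (e s)))" for x w
  proof -
    have "B x w w = (\<Sum>k\<in>UNIV. w $ k * B x (axis k 1) w)"
      by (rule linear_vec_sum_axis[OF lin(2)])
    also have "\<dots> = (\<Sum>k\<in>UNIV. \<Sum>l\<in>UNIV. w $ k * (w $ l * B x (axis k 1) (axis l 1)))"
      by (subst linear_vec_sum_axis[OF lin2]) (simp add: sum_distrib_left)
    also have "\<dots> = (\<Sum>r = 0..<m. \<Sum>s = 0..<m. w $ b r * (w $ b s * B x (e r) (e s)))"
      unfolding e_def
      by (subst sum.reindex_bij_betw[OF b, symmetric],
          subst sum.reindex_bij_betw[OF b, symmetric]) simp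
    finally show ?thesis .
  qed
  have quad: "scalar_prod u (linear_pencil m A x *\<^sub>v u) =
      (\<Sum>r = 0..<m. \<Sum>s = 0..<m. vec_index u r * (vec_index u s * B x (e r) (e s)))"
    if "u \<in> carrier_vec m" for u x
    using that unfolding pencil
    by (auto simp: scalar_prod_def sum_distrib_left mult_mat_vec_def intro!: sum.cong)
  have "(\<forall>u. 0 \<le> B x u u) \<longleftrightarrow> psd_mat m (linear_pencil m A x)" for x
  proof
    assume *: "\<forall>u. 0 \<le> B x u u"
    show "psd_mat m (linear_pencil m A x)"
      unfolding psd_mat_def
    proof (intro conjI P ballI)
      fix u :: "real Matrix.vec" assume u: "u \<in> carrier_vec m"
      define w :: "real ^ 'k" where "w = (\<chi> k. vec_index u (inv_into {0..<m} b k))"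
      have w: "w $ b r = vec_index u r" if "r < m" for r
        using that bij_betw_inv_into_left[OF b] by (simp add: w_def)
      have "scalar_prod u (linear_pencil m A x *\<^sub>v u) = B x w w"
        unfolding quad[OF u] expand by (intro sum.cong refl) (simp add: w)
      then show "scalar_prod u (linear_pencil m A x *\<^sub>v u) \<ge> 0"
        using * by simp
    qed
  next
    assume *: "psd_mat m (linear_pencil m A x)"
    show "\<forall>u. 0 \<le> B x u u"
    proof
      fix w :: "real ^ 'k"
      define u where "u = Matrix.vec m (\<lambda>r. w $ b r)"
      have u: "u \<in> carrier_vec m"
        by (simp add: u_def)
      have "B x w w = scalar_prod u (linear_pencil m A x *\<^sub>v u)"
        unfolding quad[OF u] expand by (intro sum.cong refl) (simp add: u_def)
      then show "0 \<le> B x w w"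
        using * u unfolding psd_mat_def by simp
    qed
  qed
  then show ?thesis
    unfolding spectrahedral_def using A by blast
qed

section \<open>The network with effective conductance proportional to \<open>e\<^sub>3 / e\<^sub>2\<close>\<close>

definition psum :: "nat \<Rightarrow> real ^ 'i::finite \<Rightarrow> real" where
  "psum k z = (\<Sum>i\<in>UNIV. (z $ i) ^ k)"

text \<open>Elementary symmetric polynomials in Newton's form. With power sums alone,
  \<open>esym3\<close> of a linear lift can later be computed moment by moment.\<close>

definition esym2 :: "real ^ 'i::finite \<Rightarrow> real" where
  "esym2 z = ((psum 1 z)\<^sup>2 - psum 2 z) / 2"

definition esym3 :: "real ^ 'i::finite \<Rightarrow> real" where
  "esym3 z = (psum 1 z ^ 3 - 3 * psum 1 z * psum 2 z + 2 * psum 3 z) / 6"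

text \<open>Energy of the network: \<open>a\<close> is the source potential, \<open>f i\<close> and
  \<open>w i j\<close> are the potentials of the middle nodes and leaves, and the ground has
  potential 0. The factor 1/2 compensates that each pair of indices other than \<open>i\<close>
  occurs in two of the paths through leaves.\<close>

definition network_form ::
  "real ^ 'i::finite \<Rightarrow> real \<Rightarrow> ('i \<Rightarrow> real) \<Rightarrow> ('i \<Rightarrow> 'i \<Rightarrow> real) \<Rightarrow> real" where
  "network_form z a f w =
     (\<Sum>i\<in>UNIV. z $ i * (a - f i)\<^sup>2 +
        (\<Sum>j\<in>UNIV - {i}. z $ j * (f i - w i j)\<^sup>2 + (psum 1 z - z $ i - z $ j) * (w i j)\<^sup>2) / 2)"

text \<open>Completing the square in each \<open>w i j\<close>, whose critical value is the voltage
  divider \<open>z $ j * f i / T i\<close>. Half the sum of the remaining series conductances is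
  \<open>esym2 z / T i - z $ i\<close>, the quotient e_2 / e_1 of the variables other than
  \<open>z $ i\<close>.\<close>

lemma network_form_eliminate_leaves:
  fixes z :: "real ^ 'i::finite"
  assumes T: "\<And>i. psum 1 z - z $ i \<noteq> 0"
  defines "T \<equiv> \<lambda>i. psum 1 z - z $ i"
  shows "network_form z a f w =
    (\<Sum>i\<in>UNIV. (\<Sum>j\<in>UNIV - {i}. T i * (w i j - z $ j * f i / T i)\<^sup>2) / 2 +
       (z $ i * (a - f i)\<^sup>2 + (esym2 z / T i - z $ i) * (f i)\<^sup>2))"
proof -
  have "(\<Sum>j\<in>UNIV - {i}. z $ j * (f i - w i j)\<^sup>2 + (psum 1 z - z $ i - z $ j) * (w i j)\<^sup>2) =
    (\<Sum>j\<in>UNIV - {i}. T i * (w i j - z $ j * f i / T i)\<^sup>2) + 2 * (esym2 z / T i - z $ i) * (f i)\<^sup>2" for i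
  proof -
    have Ti: "T i \<noteq> 0" using T by (simp add: T_def)
    have "(\<Sum>j\<in>UNIV - {i}. z $ j * (f i - w i j)\<^sup>2 + (psum 1 z - z $ i - z $ j) * (w i j)\<^sup>2) =
      (\<Sum>j\<in>UNIV - {i}. T i * (w i j - z $ j * f i / T i)\<^sup>2 + z $ j * (T i - z $ j) * ((f i)\<^sup>2 / T i))"
    proof (intro sum.cong refl)
      fix j
      have "z $ j * (f i - w i j)\<^sup>2 + (T i - z $ j) * (w i j)\<^sup>2 =
        T i * (w i j - z $ j * f i / T i)\<^sup>2 + z $ j * (T i - z $ j) * ((f i)\<^sup>2 / T i)"
        using Ti by (simp add: power2_eq_square divide_simps) (simp add: algebra_simps)
      then show "z $ j * (f i - w i j)\<^sup>2 + (psum 1 z - z $ i - z $ j) * (w i j)\<^sup>2 =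
        T i * (w i j - z $ j * f i / T i)\<^sup>2 + z $ j * (T i - z $ j) * ((f i)\<^sup>2 / T i)"
        by (simp add: T_def)
    qed
    also have "\<dots> = (\<Sum>j\<in>UNIV - {i}. T i * (w i j - z $ j * f i / T i)\<^sup>2) +
        (\<Sum>j\<in>UNIV - {i}. z $ j * (T i - z $ j)) * ((f i)\<^sup>2 / T i)"
      by (simp only: sum.distrib sum_distrib_right)
    also have "(\<Sum>j\<in>UNIV - {i}. z $ j * (T i - z $ j)) = 2 * (esym2 z - z $ i * T i)"
    proof -
      have "(\<Sum>j\<in>UNIV. z $ j * (T i - z $ j)) = psum 1 z * T i - psum 2 z"
        by (simp add: psum_def sum_subtractf sum_distrib_right right_diff_distrib power2_eq_square)
      moreover have "(\<Sum>j\<in>UNIV - {i}. z $ j * (T i - z $ j)) =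
          (\<Sum>j\<in>UNIV. z $ j * (T i - z $ j)) - z $ i * (T i - z $ i)"
        by (simp add: sum_diff1)
      ultimately have "(\<Sum>j\<in>UNIV - {i}. z $ j * (T i - z $ j)) = psum 1 z * T i - psum 2 z - z $ i * (T i - z $ i)"
        by simp
      moreover have "psum 2 z = (psum 1 z)\<^sup>2 - 2 * esym2 z"
        by (simp add: esym2_def field_simps)
      ultimately show ?thesis
        by (simp only: T_def) (simp add: power2_eq_square algebra_simps)
    qed
    also have "2 * (esym2 z - z $ i * T i) * ((f i)\<^sup>2 / T i) = 2 * (esym2 z / T i - z $ i) * (f i)\<^sup>2"
      using Ti by (simp add: field_simps)
    finally show ?thesis .
  qed
  then show ?thesis
    unfolding network_form_def by (intro sum.cong refl) (simp add: left_diff_distrib add_divide_distrib)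
qed

text \<open>The same elimination for the middle nodes. The remaining conductances are
  \<open>z $ i\<close> times e_2 of the other variables, divided by \<open>esym2 z\<close>; their
  sum has numerator 3 e_3, as each product of three variables arises once from each of its
  factors.\<close>

lemma network_form_complete_squares:
  fixes z :: "real ^ 'i::finite"
  assumes T: "\<And>i. psum 1 z - z $ i \<noteq> 0" and e: "esym2 z \<noteq> 0"
  defines "T \<equiv> \<lambda>i. psum 1 z - z $ i"
  shows "network_form z a f w =
    (\<Sum>i\<in>UNIV. (\<Sum>j\<in>UNIV - {i}. T i * (w i j - z $ j * f i / T i)\<^sup>2) / 2 +
       esym2 z / T i * (f i - z $ i * T i * a / esym2 z)\<^sup>2) + 3 * esym3 z / esym2 z * a\<^sup>2"
proof -
  have "z $ i * (a - f i)\<^sup>2 + (esym2 z / T i - z $ i) * (f i)\<^sup>2 =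
      esym2 z / T i * (f i - z $ i * T i * a / esym2 z)\<^sup>2
       + (z $ i * esym2 z - (z $ i)\<^sup>2 * T i) * (a\<^sup>2 / esym2 z)" for i
    using e T[of i] unfolding T_def
    by (simp add: power2_eq_square divide_simps) (simp add: algebra_simps)
  moreover have "(\<Sum>i\<in>UNIV. z $ i * esym2 z - (z $ i)\<^sup>2 * T i) = 3 * esym3 z"
  proof -
    have "(\<Sum>i\<in>UNIV. z $ i * esym2 z - (z $ i)\<^sup>2 * T i) =
        psum 1 z * esym2 z - psum 2 z * psum 1 z + psum 3 z"
    proof -
      have "z $ i * esym2 z - (z $ i)\<^sup>2 * T i = z $ i * esym2 z - (z $ i)\<^sup>2 * psum 1 z + z $ i ^ 3" for i
        by (simp add: T_def power2_eq_square power3_eq_cube algebra_simps)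
      then show ?thesis
        by (simp only: sum.distrib sum_subtractf sum_distrib_right[symmetric]) (simp add: psum_def)
    qed
    then show ?thesis
      by (simp add: esym2_def esym3_def power2_eq_square power3_eq_cube field_simps)
  qed
  ultimately show ?thesis
    unfolding network_form_eliminate_leaves[OF T]
    by (simp add: T_def sum.distrib sum_distrib_right[symmetric] sum_divide_distrib[symmetric])
qed

text \<open>Positivity of \<open>esym2 z\<close> means \<open>psum 2 z < (psum 1 z)^2\<close>, so
  every entry is below \<open>psum 1 z\<close>. Then all coefficients in the completed squares are
  nonnegative.\<close>

lemma network_form_nonneg:
  fixes z :: "real ^ 'i::finite"
  assumes 1: "psum 1 z > 0" and 2: "esym2 z > 0" and 3: "esym3 z > 0"
  shows "network_form z a f w \<ge> 0"
proof -
  have T: "psum 1 z - z $ i > 0" for i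
  proof -
    have "(z $ i)\<^sup>2 \<le> psum 2 z"
      unfolding psum_def by (rule member_le_sum) auto
    also have "\<dots> < (psum 1 z)\<^sup>2"
      using 2 by (simp add: esym2_def)
    finally show ?thesis
      using 1 by (simp add: power2_less_imp_less)
  qed
  have T0: "psum 1 z - z $ i \<noteq> 0" and T': "psum 1 z - z $ i \<ge> 0" for i
    using T[of i] by linarith+
  have "esym2 z \<noteq> 0" and "esym2 z \<ge> 0"
    using 2 by linarith+
  then show ?thesis
    unfolding network_form_complete_squares[OF T0 \<open>esym2 z \<noteq> 0\<close>] using 3 T'
    by (intro add_nonneg_nonneg sum_nonneg divide_nonneg_nonneg mult_nonneg_nonneg) auto
qed

text \<open>Test potentials isolate one coefficient at a time: a single leaf gives
  \<open>psum 1 z - z $ i\<close> (a second index must exist), a single middle node with critical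
  leaves gives \<open>esym2 z\<close>, and critical values at all inner nodes give
  \<open>esym3 z\<close>.\<close>

lemma network_form_positive_definiteD:
  fixes z :: "real ^ 'i::finite"
  assumes card: "CARD('i) \<ge> 2"
    and pd: "\<And>a f w. a \<noteq> 0 \<or> (\<exists>i. f i \<noteq> 0) \<or> (\<exists>i j. i \<noteq> j \<and> w i j \<noteq> 0) \<Longrightarrow> network_form z a f w > 0"
  shows "esym2 z > 0" "esym3 z > 0"
proof -
  have T: "psum 1 z - z $ i > 0" for i
  proof -
    have "UNIV \<noteq> {i}"
      using card by (metis card_1_singleton_iff Suc_1 not_less_eq_eq order_refl One_nat_def)
    then obtain j where j: "j \<noteq> i" by blast
    define w where "w k l = (if k = i \<and> l = j then 1 else 0::real)" for k l
    have "0 < network_form z 0 (\<lambda>_. 0) w"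
      using j by (intro pd) (auto simp: w_def)
    also have "\<dots> = (\<Sum>k\<in>UNIV. if k = i then (\<Sum>l\<in>UNIV - {i}. if l = j then psum 1 z - z $ i else 0) / 2 else 0)"
    proof -
      have "z $ l * (0 - w k l)\<^sup>2 + (psum 1 z - z $ k - z $ l) * (w k l)\<^sup>2 =
          (if k = i then if l = j then psum 1 z - z $ i else 0 else 0)" for k l
        by (simp add: w_def)
      then show ?thesis
        unfolding network_form_def by (intro sum.cong refl) simp
    qed
    also have "\<dots> = (psum 1 z - z $ i) / 2"
      using j by simp
    finally show ?thesis by simp
  qed
  then have T0: "psum 1 z - z $ i \<noteq> 0" for i
    by (metis less_irrefl)
  show e2: "esym2 z > 0"
  proof -
    obtain i :: 'i where True by simp
    define f where "f k = (if k = i then 1 else 0::real)" for k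
    have "0 < network_form z 0 f (\<lambda>i j. z $ j * f i / (psum 1 z - z $ i))"
      by (intro pd) (auto simp: f_def)
    also have "\<dots> = (\<Sum>k\<in>UNIV. if k = i then esym2 z / (psum 1 z - z $ i) else 0)"
    proof -
      have "z $ k * (0 - f k)\<^sup>2 + (esym2 z / (psum 1 z - z $ k) - z $ k) * (f k)\<^sup>2 =
          (if k = i then esym2 z / (psum 1 z - z $ k) else 0)" for k
        by (simp add: f_def)
      then show ?thesis
        by (subst network_form_eliminate_leaves[OF T0]) (simp cong: if_cong)
    qed
    finally show ?thesis
      using T[of i] by (simp add: zero_less_divide_iff)
  qed
  show "esym3 z > 0"
  proof -
    define f where "f i = z $ i * (psum 1 z - z $ i) / esym2 z" for i
    have "0 < network_form z 1 f (\<lambda>i j. z $ j * f i / (psum 1 z - z $ i))"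
      by (intro pd) auto
    also have "\<dots> = 3 * esym3 z / esym2 z"
      using e2 by (subst network_form_complete_squares[OF T0]) (auto simp: f_def)
    finally show ?thesis
      using e2 by (simp add: zero_less_divide_iff)
  qed
qed

text \<open>Zero energy forces equal potentials across every edge of positive conductance, so the
  value 0 spreads from the ground to the leaves, the middle nodes and the source. Individual entries
  of \<open>v\<close> may vanish, which happens for the lift with parameter 0.\<close>

lemma network_form_weights_positive:
  fixes v :: "real ^ 'i::finite"
  assumes v: "\<And>i. v $ i \<ge> 0" and v1: "\<And>i. psum 1 v - v $ i > 0"
    and v2: "\<And>i j. i \<noteq> j \<Longrightarrow> psum 1 v - v $ i - v $ j > 0"
    and nz: "a \<noteq> 0 \<or> (\<exists>i. f i \<noteq> 0) \<or> (\<exists>i j. i \<noteq> j \<and> w i j \<noteq> 0)"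
  shows "network_form v a f w > 0"
proof (rule ccontr)
  let ?t = "\<lambda>i j. v $ j * (f i - w i j)\<^sup>2 + (psum 1 v - v $ i - v $ j) * (w i j)\<^sup>2"
  assume "\<not> network_form v a f w > 0"
  moreover have t: "?t i j \<ge> 0" if "i \<noteq> j" for i j
    using v v2[OF that] by (intro add_nonneg_nonneg mult_nonneg_nonneg) auto
  then have ts: "(\<Sum>j\<in>UNIV - {i}. ?t i j) \<ge> 0" for i
    by (intro sum_nonneg) auto
  have s: "v $ i * (a - f i)\<^sup>2 + (\<Sum>j\<in>UNIV - {i}. ?t i j) / 2 \<ge> 0" for i
    using v ts by (intro add_nonneg_nonneg mult_nonneg_nonneg) auto
  ultimately have "network_form v a f w = 0"
    unfolding network_form_def by (meson linorder_not_less order_antisym sum_nonneg)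
  then have s0: "v $ i * (a - f i)\<^sup>2 + (\<Sum>j\<in>UNIV - {i}. ?t i j) / 2 = 0" for i
    unfolding network_form_def using s by (subst (asm) sum_nonneg_eq_0_iff) auto
  have vi: "v $ i * (a - f i)\<^sup>2 \<ge> 0" for i
    using v by simp
  have a: "v $ i * (a - f i)\<^sup>2 = 0" and "(\<Sum>j\<in>UNIV - {i}. ?t i j) = 0" for i
    using s0[of i] ts[of i] vi[of i] by linarith+
  then have t0: "?t i j = 0" if "i \<noteq> j" for i j
    using that t by (subst (asm) sum_nonneg_eq_0_iff) auto
  have w0: "w i j = 0" and f: "v $ j * (f i - w i j)\<^sup>2 = 0" if "i \<noteq> j" for i j
  proof -
    have "v $ j * (f i - w i j)\<^sup>2 \<ge> 0" "(psum 1 v - v $ i - v $ j) * (w i j)\<^sup>2 \<ge> 0"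
      using v v2[OF that] by auto
    then have "v $ j * (f i - w i j)\<^sup>2 = 0" "(psum 1 v - v $ i - v $ j) * (w i j)\<^sup>2 = 0"
      using t0[OF that] by linarith+
    then show "w i j = 0" "v $ j * (f i - w i j)\<^sup>2 = 0"
      using v2[OF that] by auto
  qed
  have ex: "\<exists>j. j \<noteq> i \<and> v $ j > 0" for i
  proof (rule ccontr)
    assume "\<not> ?thesis"
    then have "v $ j = 0" if "j \<noteq> i" for j
      using v that by (meson order_antisym not_le)
    then have "psum 1 v = (\<Sum>j\<in>UNIV. if j = i then v $ i else 0)"
      unfolding psum_def by (intro sum.cong) auto
    then show False
      using v1[of i] by simp
  qed
  have f0: "f i = 0" for i
  proof -
    obtain j where j: "j \<noteq> i" "v $ j > 0"
      using ex by blast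
    then show ?thesis
      using f[of i j] w0[of i j] by simp
  qed
  moreover have "a = 0"
  proof -
    obtain j where "v $ j > 0"
      using ex by blast
    then show ?thesis
      using a[of j] f0[of j] by simp
  qed
  ultimately show False
    using nz w0 by blast
qed

section \<open>The region where e_1, e_2 and e_3 are positive\<close>

lemma abs_psum3_le:
  fixes z :: "real ^ 'i::finite"
  assumes "psum 2 z = c\<^sup>2"
  shows "\<bar>psum 3 z\<bar> \<le> \<bar>c\<bar> ^ 3"
proof -
  have z: "\<bar>z $ i\<bar> \<le> \<bar>c\<bar>" for i
  proof -
    have "(z $ i)\<^sup>2 \<le> psum 2 z"
      unfolding psum_def by (rule member_le_sum) auto
    then show ?thesis
      using assms by (simp add: abs_le_square_iff)
  qed
  have "\<bar>psum 3 z\<bar> \<le> (\<Sum>i\<in>UNIV. \<bar>(z $ i) ^ 3\<bar>)"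
    unfolding psum_def by (rule sum_abs)
  also have "\<dots> \<le> (\<Sum>i\<in>UNIV. \<bar>c\<bar> * (z $ i)\<^sup>2)"
  proof (rule sum_mono)
    fix i
    have "\<bar>(z $ i) ^ 3\<bar> = \<bar>z $ i\<bar> * (z $ i)\<^sup>2"
      by (simp add: power3_eq_cube power2_eq_square abs_mult)
    then show "\<bar>(z $ i) ^ 3\<bar> \<le> \<bar>c\<bar> * (z $ i)\<^sup>2"
      using z by (simp add: mult_right_mono)
  qed
  also have "\<dots> = \<bar>c\<bar> * c\<^sup>2"
    using assms by (simp add: sum_distrib_left[symmetric] psum_def)
  also have "\<dots> = \<bar>c\<bar> ^ 3"
    by (simp add: power3_eq_cube power2_eq_square)
  finally show ?thesis .
qed

lemma psum2_nonneg: "psum 2 z \<ge> 0"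
  unfolding psum_def by (intro sum_nonneg) auto

lemma psum2_eq_0_iff: "psum 2 z = 0 \<longleftrightarrow> z = 0"
  unfolding psum_def by (simp add: sum_nonneg_eq_0_iff Finite_Cartesian_Product.vec_eq_iff)

text \<open>The boundary of the region e_1 > 0, e_2 > 0 contains no point with e_3 > 0: if e_1 = 0
  then e_2 < 0, and if e_2 = 0 then e_3 is a third of \<open>psum 3 z - psum 1 z ^ 3\<close>, which
  is at most 0. The minimum packs both conditions into one continuous function.\<close>

lemma esym_min_nonzero:
  fixes z :: "real ^ 'i::finite"
  assumes 3: "esym3 z > 0"
  shows "min (psum 1 z) (esym2 z) \<noteq> 0"
proof
  assume 0: "min (psum 1 z) (esym2 z) = 0"
  have "psum 3 (0 :: real ^ 'i) = 0" "psum 1 (0 :: real ^ 'i) = 0"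
    by (simp_all add: psum_def)
  then have "z \<noteq> 0"
    using 3 by (auto simp: esym3_def)
  then have q: "psum 2 z > 0"
    using psum2_nonneg[of z] psum2_eq_0_iff[of z] by linarith
  have p1: "psum 1 z \<ge> 0"
    using min.cobounded1[of "psum 1 z" "esym2 z"] unfolding 0 .
  show False
  proof (cases "psum 1 z = 0")
    case True
    have "esym2 z \<ge> 0"
      using min.cobounded2[of "psum 1 z" "esym2 z"] unfolding 0 .
    then show False using True q by (simp add: esym2_def)
  next
    case False
    then have "esym2 z = 0"
      using 0 by (auto simp only: min_def split: if_splits)
    then have e: "psum 2 z = (psum 1 z)\<^sup>2" by (simp add: esym2_def)
    then have "psum 3 z \<le> psum 1 z ^ 3"
      using abs_psum3_le[OF e] p1 by simp
    then show False
      using 3 e by (simp add: esym3_def power2_eq_square power3_eq_cube)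
  qed
qed

lemma continuous_on_psum [continuous_intros]:
  "continuous_on S f \<Longrightarrow> continuous_on S (\<lambda>t. psum k (f t))"
  unfolding psum_def by (intro continuous_intros)

lemma continuous_on_esym2 [continuous_intros]:
  "continuous_on S f \<Longrightarrow> continuous_on S (\<lambda>t. esym2 (f t))"
  unfolding esym2_def by (intro continuous_intros) auto

lemma continuous_on_esym3 [continuous_intros]:
  "continuous_on S f \<Longrightarrow> continuous_on S (\<lambda>t. esym3 (f t))"
  unfolding esym3_def by (intro continuous_intros) auto

lemma continuous_nonzero_keeps_sign:
  fixes g :: "real \<Rightarrow> real"
  assumes "continuous_on {0..1} g" "\<And>t. t \<in> {0..1} \<Longrightarrow> g t \<noteq> 0" "g 1 > 0" "t \<in> {0..1}"
  shows "g t > 0"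
proof (rule ccontr)
  assume "\<not> g t > 0"
  moreover have "continuous_on {t..1} g"
    using assms(4) by (intro continuous_on_subset[OF assms(1)]) auto
  ultimately obtain s where "s \<ge> t" "s \<le> 1" "g s = 0"
    using IVT'[of g t 0 1] assms(3,4) by auto
  then show False
    using assms(2)[of s] assms(4) by auto
qed

text \<open>Two sign arguments from the end \<open>v\<close>: first \<open>esym3\<close> stays
  positive along the segment, and this in turn keeps the minimum of \<open>psum 1\<close> and
  \<open>esym2\<close> away from 0.\<close>

lemma esym_positive_on_segment:
  fixes y v :: "real ^ 'i::finite"
  assumes nz: "\<And>t. t \<in> {0..1} \<Longrightarrow> esym3 ((1 - t) *\<^sub>R y + t *\<^sub>R v) \<noteq> 0"
    and v: "psum 1 v > 0" "esym2 v > 0" "esym3 v > 0"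
  shows "psum 1 y > 0" "esym2 y > 0" "esym3 y > 0"
proof -
  let ?l = "\<lambda>t::real. (1 - t) *\<^sub>R y + t *\<^sub>R v"
  have l: "continuous_on {0..1} ?l"
    by (intro continuous_intros)
  have 3: "esym3 (?l t) > 0" if t: "t \<in> {0..1}" for t
    by (rule continuous_nonzero_keeps_sign[of "\<lambda>t. esym3 (?l t)", OF continuous_on_esym3[OF l] _ _ t])
       (use nz v in auto)
  have m: "min (psum 1 (?l t)) (esym2 (?l t)) > 0" if t: "t \<in> {0..1}" for t
  proof (rule continuous_nonzero_keeps_sign[of "\<lambda>t. min (psum 1 (?l t)) (esym2 (?l t))", OF _ _ _ t])
    show "continuous_on {0..1} (\<lambda>t. min (psum 1 (?l t)) (esym2 (?l t)))"
      by (intro continuous_on_min continuous_on_psum continuous_on_esym2 l)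
    show "min (psum 1 (?l t)) (esym2 (?l t)) \<noteq> 0" if "t \<in> {0..1}" for t
      by (rule esym_min_nonzero[OF 3[OF that]])
  qed (use v in simp)
  show "psum 1 y > 0" "esym2 y > 0" "esym3 y > 0"
    using 3[of 0] m[of 0] by auto
qed

section \<open>The cone of e_3 as the semidefinite region of the network form\<close>

lemma psum_scaleR: "psum k (c *\<^sub>R z) = c ^ k * psum k z"
  by (simp add: psum_def power_mult_distrib sum_distrib_left)

lemma psum1_add: "psum 1 (x + y) = psum 1 x + psum 1 y"
  by (simp add: psum_def sum.distrib)

lemma esym3_scaleR: "esym3 (c *\<^sub>R z) = c ^ 3 * esym3 z"
  by (simp add: esym3_def psum_scaleR power2_eq_square power3_eq_cube algebra_simps add_divide_distrib diff_divide_distrib)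

lemma network_form_add_scaleR:
  "network_form (x + t *\<^sub>R y) a f w = network_form x a f w + t * network_form y a f w"
proof -
  have "(\<Sum>j\<in>A. (x + t *\<^sub>R y) $ j * (f i - w i j)\<^sup>2 +
       (psum 1 (x + t *\<^sub>R y) - (x + t *\<^sub>R y) $ i - (x + t *\<^sub>R y) $ j) * (w i j)\<^sup>2) =
     (\<Sum>j\<in>A. x $ j * (f i - w i j)\<^sup>2 + (psum 1 x - x $ i - x $ j) * (w i j)\<^sup>2) +
     t * (\<Sum>j\<in>A. y $ j * (f i - w i j)\<^sup>2 + (psum 1 y - y $ i - y $ j) * (w i j)\<^sup>2)" for A i
    unfolding sum_distrib_left sum.distrib[symmetric] psum1_add psum_scaleR
    by (intro sum.cong refl) (simp add: algebra_simps)
  note leaves = this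
  have "network_form (x + t *\<^sub>R y) a f w = (\<Sum>i\<in>UNIV. (x $ i * (a - f i)\<^sup>2 +
        (\<Sum>j\<in>UNIV - {i}. x $ j * (f i - w i j)\<^sup>2 + (psum 1 x - x $ i - x $ j) * (w i j)\<^sup>2) / 2) +
      t * (y $ i * (a - f i)\<^sup>2 +
        (\<Sum>j\<in>UNIV - {i}. y $ j * (f i - w i j)\<^sup>2 + (psum 1 y - y $ i - y $ j) * (w i j)\<^sup>2) / 2))"
    unfolding network_form_def leaves
    by (intro sum.cong refl) (simp add: distrib_left distrib_right add_divide_distrib)
  then show ?thesis
    unfolding network_form_def by (simp only: sum.distrib sum_distrib_left[symmetric] distrib_left)
qed

text \<open>Forwards, each \<open>z + t v\<close> with t > 0 is joined to \<open>v\<close> without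
  meeting a zero of \<open>esym3\<close>, so its form is nonnegative, and t tends to 0. Backwards,
  adding a positive multiple of the positive definite form at \<open>v\<close> makes the form at
  \<open>z\<close> positive definite.\<close>

lemma esym3_cone_eq:
  fixes v :: "real ^ 'i::finite"
  assumes card: "CARD('i) \<ge> 2" and v: "\<And>i. v $ i \<ge> 0" "\<And>i. psum 1 v - v $ i > 0"
    "\<And>i j. i \<noteq> j \<Longrightarrow> psum 1 v - v $ i - v $ j > 0"
  shows "(\<forall>t>0. esym3 (z + t *\<^sub>R v) \<noteq> 0) \<longleftrightarrow> (\<forall>a f w. network_form z a f w \<ge> 0)"
proof
  assume L: "\<forall>t>0. esym3 (z + t *\<^sub>R v) \<noteq> 0"
  have ev: "esym2 v > 0" "esym3 v > 0"
    using network_form_positive_definiteD[OF card, of v] network_form_weights_positive[OF v] by blast+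
  have pv: "psum 1 v > 0"
    using v(1,2)[of undefined] by linarith
  have pos: "network_form (z + t *\<^sub>R v) a f w \<ge> 0" if t: "t > 0" for t a f w
  proof -
    let ?y = "z + t *\<^sub>R v"
    have "esym3 ((1 - s) *\<^sub>R ?y + s *\<^sub>R v) \<noteq> 0" if s: "s \<in> {0..1}" for s :: real
    proof (cases "s = 1")
      case False
      then have s1: "1 - s > 0" using s by simp
      \<comment> \<open>Up to the positive factor \<open>1 - s\<close>, points of the segment before
        \<open>v\<close> lie on the ray from \<open>z\<close> in direction \<open>v\<close>, where
        the hypothesis applies.\<close>
      have "(1 - s) *\<^sub>R ?y + s *\<^sub>R v = (1 - s) *\<^sub>R (z + (t + s / (1 - s)) *\<^sub>R v)"
        using s1 by (simp add: algebra_simps scaleR_add_left[symmetric] del: scaleR_add_left)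
           (simp add: field_simps)
      moreover have "t + s / (1 - s) > 0"
        using t s s1 by (simp add: add_pos_nonneg)
      ultimately show ?thesis
        using L s1 by (simp add: esym3_scaleR)
    qed (use ev in simp)
    then show ?thesis
      using esym_positive_on_segment[of ?y v] pv ev network_form_nonneg by blast
  qed
  show "\<forall>a f w. network_form z a f w \<ge> 0"
  proof (intro allI)
    fix a f w
    have "((\<lambda>t. network_form z a f w + t * network_form v a f w) \<longlongrightarrow>
        network_form z a f w + 0 * network_form v a f w) (at_right 0)"
      by (intro tendsto_intros)
    moreover have "eventually (\<lambda>t. 0 \<le> network_form z a f w + t * network_form v a f w) (at_right (0::real))"
      using pos by (auto simp: eventually_at_right_field network_form_add_scaleR intro!: exI[of _ 1])
    ultimately show "network_form z a f w \<ge> 0"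
      using tendsto_lowerbound[of _ _ "at_right (0::real)" 0] by fastforce
  qed
next
  assume R: "\<forall>a f w. network_form z a f w \<ge> 0"
  show "\<forall>t>0. esym3 (z + t *\<^sub>R v) \<noteq> 0"
  proof (intro allI impI)
    fix t :: real assume t: "t > 0"
    have "network_form (z + t *\<^sub>R v) a f w > 0"
      if "a \<noteq> 0 \<or> (\<exists>i. f i \<noteq> 0) \<or> (\<exists>i j. i \<noteq> j \<and> w i j \<noteq> 0)" for a f w
      using R network_form_weights_positive[OF v that] t
      by (simp add: network_form_add_scaleR add_nonneg_pos)
    then have "esym3 (z + t *\<^sub>R v) > 0"
      by (rule network_form_positive_definiteD(2)[OF card])
    then show "esym3 (z + t *\<^sub>R v) \<noteq> 0"
      by simp
  qed
qed

lemma linear_mult_real: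
  fixes f :: "'a::real_vector \<Rightarrow> real"
  assumes "linear f"
  shows "linear (\<lambda>x. f x * c)" "linear (\<lambda>x. c * f x)" "linear (\<lambda>x. f x / c)"
  using assms by (simp_all add: linear_iff algebra_simps add_divide_distrib)

lemma linear_vec_nth: "linear z \<Longrightarrow> linear (\<lambda>x. z x $ i)"
  by (simp add: linear_iff)

lemma spectrahedral_esym3_cone:
  fixes z :: "real ^ 'n::finite \<Rightarrow> real ^ 'i::finite"
  assumes z: "linear z" and card: "CARD('i) \<ge> 2"
    and d: "\<And>i. z d $ i \<ge> 0" "\<And>i. psum 1 (z d) - z d $ i > 0"
      "\<And>i j. i \<noteq> j \<Longrightarrow> psum 1 (z d) - z d $ i - z d $ j > 0"
  shows "spectrahedral {x. \<forall>t>0. esym3 (z (x + t *\<^sub>R d)) \<noteq> 0}"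
proof -
  \<comment> \<open>The product type puts source, middle nodes and leaves into one finite index
    type; \<open>B\<close> below is the polarisation of the energy form.\<close>
  define src :: "'i option \<times> 'i option" where "src = (None, None)"
  define mid :: "'i \<Rightarrow> 'i option \<times> 'i option" where "mid i = (Some i, None)" for i
  define leaf :: "'i \<Rightarrow> 'i \<Rightarrow> 'i option \<times> 'i option" where "leaf i j = (Some i, Some j)" for i j
  define B where "B x u v =
     (\<Sum>i\<in>UNIV. z x $ i * ((u $ src - u $ mid i) * (v $ src - v $ mid i)) +
        (\<Sum>j\<in>UNIV - {i}. z x $ j * ((u $ mid i - u $ leaf i j) * (v $ mid i - v $ leaf i j)) +
           (psum 1 (z x) - z x $ i - z x $ j) * (u $ leaf i j * v $ leaf i j)) / 2)"
    for x :: "real ^ 'n" and u v :: "real ^ ('i option \<times> 'i option)"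
  have B: "B x u u = network_form (z x) (u $ src) (\<lambda>i. u $ mid i) (\<lambda>i j. u $ leaf i j)" for x u
    by (simp add: B_def network_form_def power2_eq_square)
  have "(\<forall>u. 0 \<le> B x u u) \<longleftrightarrow> (\<forall>a f w. network_form (z x) a f w \<ge> 0)" for x
  proof
    assume L: "\<forall>u. 0 \<le> B x u u"
    show "\<forall>a f w. network_form (z x) a f w \<ge> 0"
    proof (intro allI)
      fix a f w
      define u :: "real ^ ('i option \<times> 'i option)" where
        "u = (\<chi> k. case k of (None, _) \<Rightarrow> a | (Some i, None) \<Rightarrow> f i | (Some i, Some j) \<Rightarrow> w i j)"
      have "B x u u = network_form (z x) a f w"
        by (simp add: B u_def src_def mid_def leaf_def)
      then show "network_form (z x) a f w \<ge> 0"
        using L by metis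
    qed
  qed (simp add: B)
  moreover have "(\<forall>t>0. esym3 (z (x + t *\<^sub>R d)) \<noteq> 0) \<longleftrightarrow> (\<forall>a f w. network_form (z x) a f w \<ge> 0)" for x
    using esym3_cone_eq[OF card d, of "z x"] by (simp add: linear_add[OF z] linear_scale[OF z])
  ultimately have "{x. \<forall>t>0. esym3 (z (x + t *\<^sub>R d)) \<noteq> 0} = {x. \<forall>u. 0 \<le> B x u u}"
    by simp
  moreover have "spectrahedral {x. \<forall>u. 0 \<le> B x u u}"
  proof (rule spectrahedral_bilinear[where B = B])
    have p: "linear (\<lambda>x. psum 1 (z x))"
      unfolding psum_def power_one_right by (intro linear_compose_sum ballI linear_vec_nth z)
    show "linear (\<lambda>x. B x u v)" for u v
      unfolding B_def
      by (intro linear_compose_sum ballI linear_compose_add linear_compose_sub linear_mult_real p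
          linear_vec_nth z)
    show "linear (\<lambda>u. B x u v)" for x v
      unfolding B_def
      by (intro linear_compose_sum ballI linear_compose_add linear_mult_real(2,3)
          linear_mult_real(1) linear_compose_sub linear_vec_nth linear_id[unfolded id_def])
    show "B x u v = B x v u" for x u v
      by (simp add: B_def mult.commute)
  qed
  ultimately show ?thesis
    by simp
qed

section \<open>Symmetric cubic forms\<close>

text \<open>The span of the degree-three products of power sums, taken as a space of functions so
  that averaging over permutations can be done on values.\<close>

definition sym_cubic :: "(real ^ 'n::finite \<Rightarrow> real) \<Rightarrow> bool" where
  "sym_cubic F \<longleftrightarrow>
     (\<exists>a b c. \<forall>x. F x = a * psum 1 x ^ 3 + b * (psum 1 x * psum 2 x) + c * psum 3 x)"

lemma sym_cubic_add: "sym_cubic F \<Longrightarrow> sym_cubic G \<Longrightarrow> sym_cubic (\<lambda>x. F x + G x)"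
proof -
  assume "sym_cubic F" "sym_cubic G"
  then obtain a b c a' b' c' where
    "\<And>x. F x = a * psum 1 x ^ 3 + b * (psum 1 x * psum 2 x) + c * psum 3 x"
    "\<And>x. G x = a' * psum 1 x ^ 3 + b' * (psum 1 x * psum 2 x) + c' * psum 3 x"
    unfolding sym_cubic_def by blast
  then show ?thesis
    unfolding sym_cubic_def
    by (intro exI[of _ "a + a'"] exI[of _ "b + b'"] exI[of _ "c + c'"]) (simp add: algebra_simps)
qed

lemma sym_cubic_scale: "sym_cubic F \<Longrightarrow> sym_cubic (\<lambda>x. k * F x)"
proof -
  assume "sym_cubic F"
  then obtain a b c where
    "\<And>x. F x = a * psum 1 x ^ 3 + b * (psum 1 x * psum 2 x) + c * psum 3 x"
    unfolding sym_cubic_def by blast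
  then show ?thesis
    unfolding sym_cubic_def
    by (intro exI[of _ "k * a"] exI[of _ "k * b"] exI[of _ "k * c"]) (simp add: algebra_simps)
qed

lemma sym_cubic_power_sums:
  "sym_cubic (\<lambda>x. psum 1 x ^ 3)" "sym_cubic (\<lambda>x. psum 1 x * psum 2 x)" "sym_cubic (psum 3)"
  unfolding sym_cubic_def
  by (rule exI[of _ 1], rule exI[of _ 0], rule exI[of _ 0], simp)
     (rule exI[of _ 0], rule exI[of _ 1], rule exI[of _ 0], simp,
      rule exI[of _ 0], rule exI[of _ 0], rule exI[of _ 1], simp)

lemma sym_cubic_sum:
  assumes "finite A" "\<And>i. i \<in> A \<Longrightarrow> sym_cubic (F i)"
  shows "sym_cubic (\<lambda>x. \<Sum>i\<in>A. F i x)"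
  using assms
proof (induction A rule: finite_induct)
  case empty
  show ?case
    using sym_cubic_scale[OF sym_cubic_power_sums(3), of 0] by simp
next
  case (insert i A)
  then show ?case
    using sym_cubic_add[of "F i"] by simp
qed

lemma sym_cubic_diff: "sym_cubic F \<Longrightarrow> sym_cubic G \<Longrightarrow> sym_cubic (\<lambda>x. F x - G x)"
  using sym_cubic_add[OF _ sym_cubic_scale[of G "-1"], of F] by simp

lemma sym_cubic_cancel:
  assumes "sym_cubic (\<lambda>x. k * F x)" "k \<noteq> 0"
  shows "sym_cubic F"
  using sym_cubic_scale[OF assms(1), of "1 / k"] assms(2) by simp

section \<open>Averages over permutations\<close>

lemma sum_permutations_last:
  fixes F :: "('n::finite \<Rightarrow> 'n) \<Rightarrow> real" and g :: "'n \<Rightarrow> real"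
  assumes k: "k \<notin> J"
    and F: "\<And>\<pi> k'. k' \<notin> J \<Longrightarrow> F (\<pi> \<circ> Transposition.transpose k k') = F \<pi>"
  shows "real (CARD('n) - card J) * (\<Sum>\<pi> | \<pi> permutes UNIV. F \<pi> * g (\<pi> k)) =
    (\<Sum>\<pi> | \<pi> permutes UNIV. F \<pi> * (sum g UNIV - (\<Sum>j\<in>J. g (\<pi> j))))"
proof -
  \<comment> \<open>Swapping \<open>k\<close> with \<open>k'\<close> does not change
    \<open>F\<close>, so the factor at \<open>k\<close> can be averaged over all positions outside
    \<open>J\<close>.\<close>
  have "(\<Sum>\<pi> | \<pi> permutes UNIV. F \<pi> * g (\<pi> k')) = (\<Sum>\<pi> | \<pi> permutes UNIV. F \<pi> * g (\<pi> k))"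
    if "k' \<in> - J" for k'
    using that F[of k']
    by (subst sum_permutations_compose_right[OF permutes_swap_id[of k UNIV k']]) simp_all
  then have "(\<Sum>k'\<in>- J. \<Sum>\<pi> | \<pi> permutes UNIV. F \<pi> * g (\<pi> k')) =
      real (card (- J)) * (\<Sum>\<pi> | \<pi> permutes UNIV. F \<pi> * g (\<pi> k))"
    by simp
  moreover have "(\<Sum>k'\<in>- J. \<Sum>\<pi> | \<pi> permutes UNIV. F \<pi> * g (\<pi> k')) =
      (\<Sum>\<pi> | \<pi> permutes UNIV. F \<pi> * (\<Sum>k'\<in>- J. g (\<pi> k')))"
    by (subst sum.swap) (simp add: sum_distrib_left)
  moreover have "(\<Sum>k'\<in>- J. g (\<pi> k')) = sum g UNIV - (\<Sum>j\<in>J. g (\<pi> j))" if "\<pi> permutes UNIV" for \<pi>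
    using sum.permute[OF that, of g] by (simp add: Compl_eq_Diff_UNIV sum_diff)
  moreover have "card (- J) = CARD('n) - card J"
    by (simp add: Compl_eq_Diff_UNIV card_Diff_subset)
  ultimately show ?thesis
    by simp
qed

lemma sum_permutations_single:
  fixes g :: "'n::finite \<Rightarrow> real"
  shows "(\<Sum>\<pi> | \<pi> permutes UNIV. g (\<pi> i)) = fact CARD('n) / CARD('n) * sum g UNIV"
  using sum_permutations_last[of i "{}" "\<lambda>_. 1" g] card_permutations[of "UNIV :: 'n set" "CARD('n)"]
  by (simp add: field_simps)

lemma sum_permutations_pair:
  fixes g h :: "'n::finite \<Rightarrow> real"
  assumes "i \<noteq> j"
  shows "real (CARD('n) - 1) * (\<Sum>\<pi> | \<pi> permutes UNIV. g (\<pi> i) * h (\<pi> j)) =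
    fact CARD('n) / CARD('n) * (sum g UNIV * sum h UNIV - (\<Sum>k\<in>UNIV. g k * h k))"
proof -
  have "real (CARD('n) - 1) * (\<Sum>\<pi> | \<pi> permutes UNIV. g (\<pi> i) * h (\<pi> j)) =
      (\<Sum>\<pi> | \<pi> permutes UNIV. g (\<pi> i) * sum h UNIV - g (\<pi> i) * h (\<pi> i))"
    using sum_permutations_last[of j "{i}" "\<lambda>\<pi>. g (\<pi> i)" h] assms
    by (auto simp: right_diff_distrib transpose_def)
  also have "\<dots> = (\<Sum>\<pi> | \<pi> permutes UNIV. g (\<pi> i)) * sum h UNIV - (\<Sum>\<pi> | \<pi> permutes UNIV. g (\<pi> i) * h (\<pi> i))"
    by (simp add: sum_subtractf sum_distrib_right)
  also have "\<dots> = fact CARD('n) / CARD('n) * (sum g UNIV * sum h UNIV - (\<Sum>k\<in>UNIV. g k * h k))"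
    unfolding sum_permutations_single[of g] sum_permutations_single[of "\<lambda>k. g k * h k"]
    by (simp add: right_diff_distrib diff_divide_distrib)
  finally show ?thesis .
qed

lemma sym_cubic_orbit_square:
  fixes i j :: "'n::finite"
  shows "sym_cubic (\<lambda>x :: real ^ 'n. \<Sum>\<pi> | \<pi> permutes UNIV. (x $ \<pi> i)\<^sup>2 * x $ \<pi> j)"
proof (cases "i = j")
  case True
  have "(\<Sum>\<pi> | \<pi> permutes UNIV. (x $ \<pi> i)\<^sup>2 * x $ \<pi> j) = fact CARD('n) / CARD('n) * psum 3 x"
    for x :: "real ^ 'n"
    using True sum_permutations_single[of "\<lambda>k. (x $ k) ^ 3" i]
    by (simp add: psum_def power2_eq_square power3_eq_cube)
  then show ?thesis
    by (simp only:) (intro sym_cubic_scale sym_cubic_power_sums)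
next
  case False
  then have "card {i} < card (UNIV :: 'n set)"
    by (intro psubset_card_mono) auto
  moreover have "real (CARD('n) - 1) * (\<Sum>\<pi> | \<pi> permutes UNIV. (x $ \<pi> i)\<^sup>2 * x $ \<pi> j) =
      fact CARD('n) / CARD('n) * (psum 1 x * psum 2 x - psum 3 x)" for x :: "real ^ 'n"
    using sum_permutations_pair[OF False, of "\<lambda>k. (x $ k)\<^sup>2" "\<lambda>k. x $ k"]
    by (simp add: psum_def power2_eq_square power3_eq_cube mult.commute)
  moreover have "sym_cubic (\<lambda>x :: real ^ 'n. fact CARD('n) / CARD('n) * (psum 1 x * psum 2 x - psum 3 x))"
    by (intro sym_cubic_scale sym_cubic_diff sym_cubic_power_sums)
  ultimately show ?thesis
    by (simp add: sym_cubic_cancel[of "real (CARD('n) - 1)"])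
qed

text \<open>For distinct indices, averaging the position of the third factor replaces it by
  \<open>psum 1 x\<close> minus the other two entries. This leaves a pair orbit times
  \<open>psum 1 x\<close> and two orbits with a square.\<close>

lemma sym_cubic_orbit:
  fixes i j k :: "'n::finite"
  shows "sym_cubic (\<lambda>x :: real ^ 'n. \<Sum>\<pi> | \<pi> permutes UNIV. x $ \<pi> i * x $ \<pi> j * x $ \<pi> k)"
proof (cases "i = j \<or> i = k \<or> j = k")
  case True
  then show ?thesis
    using sym_cubic_orbit_square[of i j] sym_cubic_orbit_square[of i k] sym_cubic_orbit_square[of j i]
    by (auto simp: power2_eq_square mult_ac)
next
  case False
  \<comment> \<open>Three distinct indices exist, so the factors \<open>CARD('n) - 1\<close> and
    \<open>CARD('n) - 2\<close> can be cancelled.\<close>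
  then have "card {i, j} < card (UNIV :: 'n set)"
    by (intro psubset_card_mono) auto
  then have n: "CARD('n) - 2 > 0" "CARD('n) - 1 > 0"
    using False by auto
  have pair: "sym_cubic (\<lambda>x :: real ^ 'n. (\<Sum>\<pi> | \<pi> permutes UNIV. x $ \<pi> i * x $ \<pi> j) * psum 1 x)"
  proof (rule sym_cubic_cancel)
    have "real (CARD('n) - 1) * ((\<Sum>\<pi> | \<pi> permutes UNIV. x $ \<pi> i * x $ \<pi> j) * psum 1 x) =
      fact CARD('n) / CARD('n) * (psum 1 x ^ 3 - psum 1 x * psum 2 x)" for x :: "real ^ 'n"
    proof -
      have "real (CARD('n) - 1) * (\<Sum>\<pi> | \<pi> permutes UNIV. x $ \<pi> i * x $ \<pi> j) =
        fact CARD('n) / CARD('n) * (psum 1 x * psum 1 x - psum 2 x)"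
        using False sum_permutations_pair[of i j "\<lambda>k. x $ k" "\<lambda>k. x $ k"]
        by (simp add: psum_def power2_eq_square)
      then have "real (CARD('n) - 1) * (\<Sum>\<pi> | \<pi> permutes UNIV. x $ \<pi> i * x $ \<pi> j) * psum 1 x =
        fact CARD('n) / CARD('n) * (psum 1 x * psum 1 x - psum 2 x) * psum 1 x"
        by simp
      then show ?thesis
        by (simp add: power3_eq_cube algebra_simps)
    qed
    moreover have "sym_cubic (\<lambda>x :: real ^ 'n. fact CARD('n) / CARD('n) * (psum 1 x ^ 3 - psum 1 x * psum 2 x))"
      by (intro sym_cubic_scale sym_cubic_diff sym_cubic_power_sums)
    ultimately show "sym_cubic (\<lambda>x. real (CARD('n) - 1) * ((\<Sum>\<pi> | \<pi> permutes UNIV. x $ \<pi> i * x $ \<pi> j) * psum 1 x))"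
      by simp
  qed (use n in simp)
  show ?thesis
  proof (rule sym_cubic_cancel)
    have "real (CARD('n) - 2) * (\<Sum>\<pi> | \<pi> permutes UNIV. x $ \<pi> i * x $ \<pi> j * x $ \<pi> k) =
      (\<Sum>\<pi> | \<pi> permutes UNIV. x $ \<pi> i * x $ \<pi> j) * psum 1 x
      - (\<Sum>\<pi> | \<pi> permutes UNIV. (x $ \<pi> i)\<^sup>2 * x $ \<pi> j)
      - (\<Sum>\<pi> | \<pi> permutes UNIV. (x $ \<pi> j)\<^sup>2 * x $ \<pi> i)" for x :: "real ^ 'n"
    proof -
      have "real (CARD('n) - card {i, j}) * (\<Sum>\<pi> | \<pi> permutes UNIV. x $ \<pi> i * x $ \<pi> j * x $ \<pi> k) =
        (\<Sum>\<pi> | \<pi> permutes UNIV. x $ \<pi> i * x $ \<pi> j * ((\<Sum>l\<in>UNIV. x $ l) - (\<Sum>l\<in>{i, j}. x $ \<pi> l)))"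
        using False by (intro sum_permutations_last) (auto simp: transpose_def)
      also have "\<dots> = (\<Sum>\<pi> | \<pi> permutes UNIV. x $ \<pi> i * x $ \<pi> j * psum 1 x
          - (x $ \<pi> i)\<^sup>2 * x $ \<pi> j - (x $ \<pi> j)\<^sup>2 * x $ \<pi> i)"
        using False by (intro sum.cong refl) (simp add: psum_def power2_eq_square algebra_simps)
      finally show ?thesis
        using False by (simp add: sum_subtractf sum_distrib_right numeral_2_eq_2)
    qed
    moreover have "sym_cubic (\<lambda>x :: real ^ 'n. (\<Sum>\<pi> | \<pi> permutes UNIV. x $ \<pi> i * x $ \<pi> j) * psum 1 x
      - (\<Sum>\<pi> | \<pi> permutes UNIV. (x $ \<pi> i)\<^sup>2 * x $ \<pi> j)
      - (\<Sum>\<pi> | \<pi> permutes UNIV. (x $ \<pi> j)\<^sup>2 * x $ \<pi> i))"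
      by (intro sym_cubic_diff pair sym_cubic_orbit_square)
    ultimately show "sym_cubic (\<lambda>x. real (CARD('n) - 2) * (\<Sum>\<pi> | \<pi> permutes UNIV. x $ \<pi> i * x $ \<pi> j * x $ \<pi> k))"
      by simp
  qed (use n in simp)
qed

section \<open>From symmetric polynomials of degree three to power sums\<close>

lemma prod_powers_eq_prod_list:
  fixes g :: "'n::finite \<Rightarrow> nat"
  assumes "sum g UNIV = d"
  shows "\<exists>l. length l = d \<and> (\<forall>x :: 'n \<Rightarrow> real. (\<Prod>i\<in>UNIV. x i ^ g i) = prod_list (map x l))"
  using assms
proof (induction d arbitrary: g)
  case 0
  then show ?case by (intro exI[of _ "[]"]) simp
next
  case (Suc d)
  then have "sum g UNIV \<noteq> 0" by simp
  then obtain i where i: "g i \<noteq> 0" by (meson sum.neutral)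
  define h where "h = g(i := g i - 1)"
  have "sum g UNIV = g i + sum g (UNIV - {i})" "sum h UNIV = h i + sum h (UNIV - {i})"
    by (simp_all add: sum.remove)
  moreover have "sum h (UNIV - {i}) = sum g (UNIV - {i})"
    by (intro sum.cong) (auto simp: h_def)
  ultimately have "sum h UNIV = d"
    using Suc.prems i by (simp add: h_def)
  then obtain l where l: "length l = d" "\<And>x :: 'n \<Rightarrow> real. (\<Prod>i\<in>UNIV. x i ^ h i) = prod_list (map x l)"
    using Suc.IH by blast
  have "(\<Prod>i\<in>UNIV. x i ^ g i) = x i * (\<Prod>i\<in>UNIV. x i ^ h i)" for x :: "'n \<Rightarrow> real"
  proof -
    have "(\<Prod>k\<in>UNIV - {i}. x k ^ h k) = (\<Prod>k\<in>UNIV - {i}. x k ^ g k)"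
      by (intro prod.cong) (auto simp: h_def)
    moreover have "x i ^ g i = x i * x i ^ h i"
      using i by (simp add: h_def power_eq_if)
    ultimately show ?thesis
      by (simp add: prod.remove[of UNIV i])
  qed
  then show ?case
    using l by (intro exI[of _ "i # l"]) simp
qed

lemma length_3_conv: "length l = 3 \<longleftrightarrow> (\<exists>i j k. l = [i, j, k])"
  by (auto simp: length_Suc_conv numeral_3_eq_3)

text \<open>Averaging a symmetric polynomial over all permutations of the variables reproduces it,
  and turns each monomial \<open>x $ i * x $ j * x $ k\<close> into an orbit sum.\<close>

lemma sym_cubic_mpoly_eval:
  fixes p :: "('n::finite, real) mpoly"
  assumes sym: "symmetric_mpoly p" and hom: "homogeneous p" and deg: "total_degree p = 3"
  shows "sym_cubic (mpoly_eval p)"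
proof -
  have "\<exists>i j k. \<forall>x. (\<Prod>l\<in>UNIV. x $ l ^ Poly_Mapping.lookup m l) = x $ i * x $ j * (x $ k :: real)"
    if "m \<in> Poly_Mapping.keys p" for m
  proof -
    have "sum (Poly_Mapping.lookup m) UNIV = 3"
      using hom deg that by (simp add: homogeneous_def monom_degree_def)
    from prod_powers_eq_prod_list[OF this] obtain i j k where
      *: "\<And>x :: 'n \<Rightarrow> real. (\<Prod>l\<in>UNIV. x l ^ Poly_Mapping.lookup m l) = prod_list (map x [i, j, k])"
      unfolding length_3_conv by blast
    show ?thesis
      by (rule exI[of _ i], rule exI[of _ j], rule exI[of _ k]) (simp add: *)
  qed
  then obtain i j k where ijk: "\<And>m x. m \<in> Poly_Mapping.keys p \<Longrightarrow>
      (\<Prod>l\<in>UNIV. x $ l ^ Poly_Mapping.lookup m l) = x $ i m * x $ j m * (x $ k m :: real)"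
    by metis
  have eval: "mpoly_eval p x =
      (\<Sum>m\<in>Poly_Mapping.keys p. Poly_Mapping.lookup p m * (x $ i m * x $ j m * x $ k m))" for x
    by (simp add: mpoly_eval_def subst_vars_def ijk)
  have inv: "mpoly_eval p (\<chi> l. x $ \<pi> l) = mpoly_eval p x" if "\<pi> permutes UNIV" for x \<pi>
    using subst_vars_permute_vars[OF permutes_bij[OF that], of "\<lambda>c. c" "\<lambda>l. x $ l" p] sym that
    by (simp add: mpoly_eval_def symmetric_mpoly_def)
  have "fact CARD('n) * mpoly_eval p x =
      (\<Sum>m\<in>Poly_Mapping.keys p. Poly_Mapping.lookup p m *
         (\<Sum>\<pi> | \<pi> permutes UNIV. x $ \<pi> (i m) * x $ \<pi> (j m) * x $ \<pi> (k m)))" for x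
  proof -
    have "fact CARD('n) * mpoly_eval p x = (\<Sum>\<pi> :: 'n \<Rightarrow> 'n | \<pi> permutes UNIV. mpoly_eval p x)"
      using card_permutations[of "UNIV :: 'n set" "CARD('n)"] by simp
    also have "\<dots> = (\<Sum>\<pi> | \<pi> permutes UNIV. mpoly_eval p (\<chi> l. x $ \<pi> l))"
      by (intro sum.cong refl) (simp add: inv)
    also have "\<dots> = (\<Sum>m\<in>Poly_Mapping.keys p. \<Sum>\<pi> | \<pi> permutes UNIV.
        Poly_Mapping.lookup p m * (x $ \<pi> (i m) * x $ \<pi> (j m) * x $ \<pi> (k m)))"
      unfolding eval by (subst sum.swap) simp
    finally show ?thesis
      by (simp add: sum_distrib_left)
  qed
  then have "sym_cubic (\<lambda>x. fact CARD('n) * mpoly_eval p x)"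
    by (simp only:) (intro sym_cubic_sum sym_cubic_scale sym_cubic_orbit finite_keys)
  then show ?thesis
    by (rule sym_cubic_cancel) simp
qed

section \<open>Depressed cubics with only real roots\<close>

text \<open>Splitting off a real root \<open>a\<close> leaves the quadratic
  \<open>w^2 + a w + P + a^2\<close>, whose discriminant is \<open>- (4 * P + 3 * a^2)\<close>. This
  number is also a factor of the discriminant of the cubic, with a square as cofactor.\<close>

lemma only_real_roots_depressed_cubic:
  assumes "only_real_roots (Polynomial.smult A [:Q, P, 0, 1:])" "A \<noteq> 0"
  shows "P \<le> 0" "4 * P ^ 3 + 27 * Q\<^sup>2 \<le> 0"
proof -
  have ev: "poly (map_poly of_real (Polynomial.smult A [:Q, P, 0, 1:])) w = of_real A * (w ^ 3 + of_real P * w + of_real Q)"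
    for w :: complex
    by (simp add: map_poly_pCons power3_eq_cube algebra_simps)
  have real: "w \<in> \<real>" if "w ^ 3 + of_real P * w + of_real Q = 0" for w :: complex
    using assms that unfolding only_real_roots_def ev by simp
  have "\<not> constant (poly [:of_real Q, of_real P, 0, 1 :: complex:])"
    by (simp add: constant_degree)
  then obtain w :: complex where "poly [:of_real Q, of_real P, 0, 1:] w = 0"
    using fundamental_theorem_of_algebra by blast
  then have w: "w ^ 3 + of_real P * w + of_real Q = 0"
    by (simp add: power3_eq_cube algebra_simps)
  then obtain a where a: "w = of_real a"
    using real by (auto elim: Reals_cases)
  have "of_real (a ^ 3 + P * a + Q) = (0 :: complex)"
    using w by (simp add: a)
  then have Q: "Q = - (a ^ 3 + P * a)"
    unfolding of_real_eq_0_iff by simp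
  have D: "4 * P + 3 * a\<^sup>2 \<le> 0"
  proof (rule ccontr)
    assume "\<not> ?thesis"
    then have pos: "4 * P + 3 * a\<^sup>2 > 0" by simp
    define s where "s = sqrt (4 * P + 3 * a\<^sup>2)"
    have s: "s\<^sup>2 = 4 * P + 3 * a\<^sup>2" and s0: "s > 0"
      using pos by (simp_all add: s_def)
    \<comment> \<open>A root of the quadratic factor; it is not real when the discriminant is
      negative.\<close>
    define u where "u = Complex (- a / 2) (s / 2)"
    have P': "P = (s\<^sup>2 - 3 * a\<^sup>2) / 4"
      using s by simp
    have "u ^ 3 + of_real P * u + of_real Q = 0"
      unfolding u_def Q P'
      by (simp add: complex_eq_iff power3_eq_cube power2_eq_square field_simps)
    then have "u \<in> \<real>"
      by (rule real)
    then show False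
      using s0 by (simp add: u_def complex_is_Real_iff)
  qed
  then show "P \<le> 0"
    using zero_le_power2[of a] by linarith
  have "4 * P ^ 3 + 27 * Q\<^sup>2 = (4 * P + 3 * a\<^sup>2) * (P + 3 * a\<^sup>2)\<^sup>2"
    unfolding Q by (simp add: power2_eq_square power3_eq_cube algebra_simps)
  also have "\<dots> \<le> 0"
    using D by (simp add: mult_nonpos_nonneg)
  finally show "4 * P ^ 3 + 27 * Q\<^sup>2 \<le> 0" .
qed

section \<open>Symmetric hyperbolic cubics as pullbacks of \<open>e\<^sub>3\<close>\<close>

text \<open>With at most two variables the third central moment vanishes identically, so its
  coefficient may be taken to be 0.\<close>

lemma finite_card_le_2_sum_cube_zero:
  fixes y :: "'n::finite \<Rightarrow> real"
  assumes "CARD('n) \<le> 2" and "sum y UNIV = 0"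
  shows "(\<Sum>i\<in>UNIV. y i ^ 3) = 0"
proof -
  have "CARD('n) = 1 \<or> CARD('n) = 2"
    using assms(1) zero_less_card_finite[where ?'a = 'n] by linarith
  then show ?thesis
  proof
    assume "CARD('n) = 1"
    then obtain i :: 'n where i: "UNIV = {i}"
      by (auto simp: card_1_singleton_iff)
    show ?thesis
      using assms(2) unfolding i by simp
  next
    assume "CARD('n) = 2"
    then obtain i j :: 'n where ij: "UNIV = {i, j}" "i \<noteq> j"
      by (auto simp: card_2_iff)
    have "y j = - y i"
      using assms(2) ij(2) unfolding ij(1) by simp
    then show ?thesis
      using ij(2) unfolding ij(1) by (simp add: power3_eq_cube)
  qed
qed

section \<open>Central moments and the lift to 2n+1 coordinates\<close>

definition mean :: "real ^ 'n::finite \<Rightarrow> real" where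
  "mean x = psum 1 x / CARD('n)"

definition cmoment :: "nat \<Rightarrow> real ^ 'n::finite \<Rightarrow> real" where
  "cmoment k x = (\<Sum>i\<in>UNIV. (x $ i - mean x) ^ k)"

lemma cmoment_1: "cmoment 1 (x :: real ^ 'n::finite) = 0"
  by (simp add: cmoment_def mean_def sum_subtractf psum_def)

lemma sum_affine_powers:
  fixes x :: "real ^ 'n::finite" and a c :: real
  shows "(\<Sum>i\<in>UNIV. a + c * (x $ i - mean x)) = CARD('n) * a"
    and "(\<Sum>i\<in>UNIV. (a + c * (x $ i - mean x))\<^sup>2) = CARD('n) * a\<^sup>2 + c\<^sup>2 * cmoment 2 x"
    and "(\<Sum>i\<in>UNIV. (a + c * (x $ i - mean x)) ^ 3) =
      CARD('n) * a ^ 3 + 3 * a * c\<^sup>2 * cmoment 2 x + c ^ 3 * cmoment 3 x"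
proof -
  let ?y = "\<lambda>i. x $ i - mean x"
  have y: "sum ?y UNIV = 0"
    using cmoment_1[of x] by (simp add: cmoment_def)
  show "(\<Sum>i\<in>UNIV. a + c * ?y i) = CARD('n) * a"
    using y by (simp add: sum.distrib sum_distrib_left[symmetric])
  have "(a + c * ?y i)\<^sup>2 = a\<^sup>2 + 2 * a * c * ?y i + c\<^sup>2 * (?y i)\<^sup>2" for i
    by (simp add: power2_eq_square algebra_simps)
  then show "(\<Sum>i\<in>UNIV. (a + c * ?y i)\<^sup>2) = CARD('n) * a\<^sup>2 + c\<^sup>2 * cmoment 2 x"
    using y by (simp only: sum.distrib sum_distrib_left[symmetric]) (simp add: cmoment_def)
  have "(a + c * ?y i) ^ 3 = a ^ 3 + 3 * a\<^sup>2 * c * ?y i + 3 * a * c\<^sup>2 * (?y i)\<^sup>2 + c ^ 3 * ?y i ^ 3" for i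
    by (simp add: power2_eq_square power3_eq_cube algebra_simps)
  then show "(\<Sum>i\<in>UNIV. (a + c * ?y i) ^ 3) =
      CARD('n) * a ^ 3 + 3 * a * c\<^sup>2 * cmoment 2 x + c ^ 3 * cmoment 3 x"
    using y by (simp only: sum.distrib sum_distrib_left[symmetric]) (simp add: cmoment_def)
qed

lemma psum_eq_cmoments:
  fixes x :: "real ^ 'n::finite"
  shows "psum 1 x = CARD('n) * mean x"
    and "psum 2 x = CARD('n) * (mean x)\<^sup>2 + cmoment 2 x"
    and "psum 3 x = CARD('n) * mean x ^ 3 + 3 * mean x * cmoment 2 x + cmoment 3 x"
  using sum_affine_powers[of "mean x" 1 x] by (simp_all add: psum_def)

text \<open>The block of weight \<open>v\<close> is mirrored about the mean, so at
  \<open>v = 1\<close> the third moments of the two blocks cancel. The coordinate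
  \<open>Inr None\<close> raises the number of entries to 3 already for one variable, where e_3 of
  two entries would be zero.\<close>

definition lift_map :: "real \<Rightarrow> real \<Rightarrow> real ^ 'n::finite \<Rightarrow> real ^ ('n + 'n option)" where
  "lift_map v k x = (\<chi> l. case l of Inl i \<Rightarrow> mean x + k * (x $ i - mean x)
     | Inr None \<Rightarrow> v * mean x | Inr (Some i) \<Rightarrow> v * (mean x - k * (x $ i - mean x)))"

lemma linear_mean: "linear mean"
  by (rule linearI) (simp_all add: mean_def psum1_add psum_scaleR add_divide_distrib del: One_nat_def)

lemma linear_lift_map: "linear (lift_map v k)"
  by (rule linearI)
    (auto simp: lift_map_def Finite_Cartesian_Product.vec_eq_iff linear_add[OF linear_mean]
      linear_scale[OF linear_mean] algebra_simps split: sum.splits option.splits)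

lemma sum_UNIV_sum_option:
  fixes g :: "'a::finite + 'a option \<Rightarrow> real"
  shows "sum g UNIV = (\<Sum>i\<in>UNIV. g (Inl i)) + (g (Inr None) + (\<Sum>i\<in>UNIV. g (Inr (Some i))))"
proof -
  have "sum g UNIV = (\<Sum>i\<in>UNIV. g (Inl i)) + (\<Sum>i\<in>UNIV. g (Inr i))"
    using sum.Plus[of UNIV UNIV g] by (simp add: UNIV_Plus_UNIV)
  also have "(\<Sum>i\<in>UNIV. g (Inr i)) = g (Inr None) + (\<Sum>i\<in>UNIV. g (Inr (Some i)))"
    by (simp add: UNIV_option_conv sum.reindex)
  finally show ?thesis .
qed

lemma psum_lift_map:
  fixes x :: "real ^ 'n::finite"
  shows "psum m (lift_map v k x) = (\<Sum>i\<in>UNIV. (mean x + k * (x $ i - mean x)) ^ m)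
    + (v ^ m * mean x ^ m + v ^ m * (\<Sum>i\<in>UNIV. (mean x + (- k) * (x $ i - mean x)) ^ m))"
  unfolding psum_def sum_UNIV_sum_option
  by (simp add: lift_map_def power_mult_distrib sum_distrib_left)

definition total_weight :: "real \<Rightarrow> real \<Rightarrow> real" where
  "total_weight n v = n + (n + 1) * v"

text \<open>The value of \<open>esym3\<close> at the lifted all-ones vector, whose power sums are
  \<open>n + (n + 1) * v ^ m\<close>; \<open>total_weight\<close> is its first power sum.\<close>

definition cube_coeff :: "real \<Rightarrow> real \<Rightarrow> real" where
  "cube_coeff n v = (total_weight n v ^ 3 - 3 * total_weight n v * (n + (n + 1) * v\<^sup>2)
     + 2 * (n + (n + 1) * v ^ 3)) / 6"

definition square_coeff :: "real \<Rightarrow> real \<Rightarrow> real" where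
  "square_coeff n v = (total_weight n v * (1 + v\<^sup>2) - 2 * (1 + v ^ 3)) / 2"

lemma esym3_lift_map:
  fixes x :: "real ^ 'n::finite"
  defines "n \<equiv> real CARD('n)"
  shows "esym3 (lift_map v k x) = cube_coeff n v * mean x ^ 3
    - square_coeff n v * k\<^sup>2 * mean x * cmoment 2 x + (1 - v ^ 3) / 3 * k ^ 3 * cmoment 3 x"
proof -
  let ?s = "mean x" and ?q = "cmoment 2 x" and ?r = "cmoment 3 x"
  have p: "psum 1 (lift_map v k x) = total_weight n v * ?s"
    "psum 2 (lift_map v k x) = (n + (n + 1) * v\<^sup>2) * ?s\<^sup>2 + (1 + v\<^sup>2) * k\<^sup>2 * ?q"
    "psum 3 (lift_map v k x) = (n + (n + 1) * v ^ 3) * ?s ^ 3 + 3 * (1 + v ^ 3) * k\<^sup>2 * ?s * ?q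
       + (1 - v ^ 3) * k ^ 3 * ?r"
    unfolding psum_lift_map power_one_right sum_affine_powers
    by (simp_all add: total_weight_def n_def distrib_left distrib_right left_diff_distrib right_diff_distrib mult_ac)
  show ?thesis
    unfolding esym3_def p cube_coeff_def square_coeff_def
    by (simp add: field_simps power2_eq_square power3_eq_cube)
qed

text \<open>Eliminating \<open>k\<close> from the two coefficient equations leaves one equation in
  \<open>v\<close>, solved by the intermediate value theorem. The sign of \<open>k\<close>, lost by
  squaring, is then taken from \<open>C\<close>.\<close>

lemma lift_parameters_exist:
  fixes n B C :: real
  assumes n: "n \<ge> 1" and B: "B \<le> 0" and disc: "4 * B ^ 3 * n * (n - 1) + 27 * C\<^sup>2 * (n - 2)\<^sup>2 \<le> 0"
    and C: "n \<ge> 3 \<or> C = 0"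
  obtains v k where "0 \<le> v" "v \<le> 1" "total_weight n v \<ge> 3" "cube_coeff n v > 0"
    "cube_coeff n v * B = - square_coeff n v * k\<^sup>2" "cube_coeff n v * C = (1 - v ^ 3) / 3 * k ^ 3"
proof -
  \<comment> \<open>Comparing \<open>k ^ 6\<close> from both equations: its cube from the square
    coefficient against its square from the cubic one.\<close>
  define g where "g v = (1 - v ^ 3)\<^sup>2 * cube_coeff n v * (- B) ^ 3 - 9 * C\<^sup>2 * square_coeff n v ^ 3" for v
  have "\<exists>v. 0 \<le> v \<and> v \<le> 1 \<and> (n \<ge> 3 \<or> v = 1) \<and> g v = 0"
  proof (cases "C = 0")
    case True
    \<comment> \<open>At \<open>v = 1\<close> the cubic term of the lift vanishes, and the total
      weight \<open>2 * n + 1\<close> is at least 3 even for small \<open>n\<close>.\<close>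
    then show ?thesis
      by (intro exI[of _ 1]) (simp add: g_def)
  next
    case False
    then have n3: "n \<ge> 3" using C by simp
    have "continuous_on {0..1} g"
      unfolding g_def cube_coeff_def square_coeff_def total_weight_def
      by (intro continuous_intros) auto
    moreover have "g 1 \<le> 0"
    proof -
      have "square_coeff n 1 \<ge> 0"
        using n by (simp add: square_coeff_def total_weight_def)
      then show ?thesis by (simp add: g_def)
    qed
    moreover have "g 0 \<ge> 0"
    proof -
      \<comment> \<open>At \<open>v = 0\<close> the lift is e_3 of the first block alone, and
        \<open>g 0\<close> is a nonpositive multiple of the quantity bounded by
        \<open>disc\<close>.\<close>
      have "g 0 = - (n - 2) / 24 * (4 * B ^ 3 * n * (n - 1) + 27 * C\<^sup>2 * (n - 2)\<^sup>2)"
        by (simp add: g_def cube_coeff_def square_coeff_def total_weight_def power2_eq_square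
            power3_eq_cube field_simps)
      then show ?thesis
        using n3 disc by (simp only: ) (intro mult_nonpos_nonpos, auto)
    qed
    ultimately obtain v where "0 \<le> v" "v \<le> 1" "g v = 0"
      using IVT2'[of g 1 0 0] by auto
    then show ?thesis using n3 by blast
  qed
  then obtain v where v: "0 \<le> v" "v \<le> 1" "n \<ge> 3 \<or> v = 1" "g v = 0" by blast
  have N: "total_weight n v \<ge> 3"
  proof -
    have "n \<ge> 3 \<Longrightarrow> (n + 1) * v \<ge> 0" using v(1) by simp
    then show ?thesis using v(3) n by (auto simp: total_weight_def)
  qed
  have M: "square_coeff n v > 0"
  proof -
    have "v ^ 3 \<le> v\<^sup>2" using v(1,2) by (intro power_decreasing) auto
    then have "2 * (1 + v ^ 3) \<le> 2 * (1 + v\<^sup>2)"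
      by simp
    also have "\<dots> < 3 * (1 + v\<^sup>2)"
      by (rule mult_strict_right_mono) (simp_all add: add_pos_nonneg)
    also have "\<dots> \<le> total_weight n v * (1 + v\<^sup>2)"
      using N by (intro mult_right_mono) auto
    finally show ?thesis by (simp add: square_coeff_def)
  qed
  have L: "cube_coeff n v > 0"
  proof -
    have "6 * cube_coeff n v = n * (n - 1) * (n - 2) + 3 * (n * (n - 1) * (n + 1)) * v
        + 3 * (n * n * (n + 1)) * v\<^sup>2 + n * (n - 1) * (n + 1) * v ^ 3"
      by (simp add: cube_coeff_def total_weight_def power2_eq_square power3_eq_cube field_simps)
    also have "\<dots> > 0"
    proof (cases "v = 1")
      case True
      \<comment> \<open>All \<open>2 * n + 1\<close> lifted entries are 1 here; the closed form
        settles \<open>n < 3\<close>, where the first summand need not be positive.\<close>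
      have "n * (n - 1) * (n - 2) + 3 * (n * (n - 1) * (n + 1)) + 3 * (n * n * (n + 1)) + n * (n - 1) * (n + 1)
         = 2 * n * (2 * n + 1) * (2 * n - 1)"
        by (simp add: algebra_simps)
      then show ?thesis using True n by simp
    next
      case False
      then have "n * (n - 1) * (n - 2) > 0" using v(3) by simp
      then show ?thesis using n v(1) by (intro add_pos_nonneg) auto
    qed
    finally show ?thesis by simp
  qed
  \<comment> \<open>The absolute value of the future \<open>k\<close>, forced by the equation for
    \<open>B\<close>.\<close>
  define t where "t = sqrt (- B * cube_coeff n v / square_coeff n v)"
  have t_nonneg: "- B * cube_coeff n v / square_coeff n v \<ge> 0"
    using B L M by (intro divide_nonneg_pos mult_nonneg_nonneg) auto
  then have t2: "t\<^sup>2 = - B * cube_coeff n v / square_coeff n v"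
    unfolding t_def by (rule real_sqrt_pow2)
  have t0: "t \<ge> 0"
    unfolding t_def using t_nonneg by (rule real_sqrt_ge_zero)
  define D where "D = (1 - v ^ 3) / 3 * t ^ 3"
  have D0: "D \<ge> 0" using t0 v(1,2) by (simp add: D_def power_le_one)
  have D2: "(cube_coeff n v * C)\<^sup>2 = D\<^sup>2"
  proof -
    have "t ^ 6 = (t\<^sup>2) ^ 3" by simp
    also have "\<dots> = (- B) ^ 3 * cube_coeff n v ^ 3 / square_coeff n v ^ 3"
      unfolding t2 by (simp add: power_divide power_mult_distrib)
    finally have t6: "t ^ 6 * square_coeff n v ^ 3 = (- B) ^ 3 * cube_coeff n v ^ 3"
      using M by simp
    have "9 * D\<^sup>2 * square_coeff n v ^ 3 = (1 - v ^ 3)\<^sup>2 * (t ^ 6 * square_coeff n v ^ 3)"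
      by (simp add: D_def power_mult_distrib power_divide flip: power_mult)
    also have "\<dots> = (cube_coeff n v)\<^sup>2 * ((1 - v ^ 3)\<^sup>2 * cube_coeff n v * (- B) ^ 3)"
      unfolding t6 by (simp add: power2_eq_square power3_eq_cube)
    also have "\<dots> = (cube_coeff n v)\<^sup>2 * (9 * C\<^sup>2 * square_coeff n v ^ 3)"
      using v(4) by (simp add: g_def)
    finally show ?thesis using M by (simp add: power_mult_distrib)
  qed
  define k where "k = (if C \<ge> 0 then t else - t)"
  have k2: "k\<^sup>2 = t\<^sup>2" by (simp add: k_def)
  have "cube_coeff n v * C = (1 - v ^ 3) / 3 * k ^ 3"
  proof (cases "C \<ge> 0")
    case True
    then have "cube_coeff n v * C \<ge> 0" using L by simp
    then have "cube_coeff n v * C = D"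
      using D2 D0 by (simp add: power2_eq_iff_nonneg)
    then show ?thesis using True by (simp add: k_def D_def)
  next
    case False
    then have "- (cube_coeff n v * C) \<ge> 0" using L by (simp add: mult_le_0_iff)
    then have "- (cube_coeff n v * C) = D"
      using D2 D0 power2_eq_iff_nonneg[of "- (cube_coeff n v * C)" D] by simp
    then show ?thesis using False by (simp add: k_def D_def)
  qed
  moreover have "cube_coeff n v * B = - square_coeff n v * k\<^sup>2"
    unfolding k2 t2 using M by simp
  ultimately show ?thesis using that v(1,2) N L by blast
qed

lemma mean_all_ones: "mean (all_ones :: real ^ 'n::finite) = 1"
  by (simp add: mean_def psum_def all_ones_def)

lemma lift_map_all_ones:
  "lift_map v k (all_ones :: real ^ 'n::finite) $ l = (case l of Inl i \<Rightarrow> 1 | Inr i \<Rightarrow> v)"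
proof -
  have "(all_ones :: real ^ 'n) $ i = 1" for i
    by (simp add: all_ones_def)
  then show ?thesis
    by (simp add: lift_map_def mean_all_ones split: sum.splits option.splits)
qed

text \<open>The lifted all-ones vector has entries 1 and \<open>v\<close> in [0,1] with sum at least
  3, so the sum stays positive after removing any two entries. This is what the threshold 3 is
  for.\<close>

lemma spectrahedral_lift_cone:
  assumes "0 \<le> v" "v \<le> 1" "total_weight (real CARD('n)) v \<ge> 3"
  shows "spectrahedral {x :: real ^ 'n::finite. \<forall>t>0. esym3 (lift_map v k (x + t *\<^sub>R all_ones)) \<noteq> 0}"
proof (rule spectrahedral_esym3_cone[OF linear_lift_map])
  let ?w = "lift_map v k (all_ones :: real ^ 'n)"
  have "CARD('n) \<ge> 1" by (simp add: Suc_le_eq)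
  then show "CARD('n + 'n option) \<ge> 2"
    by (simp add: card_UNIV_sum card_UNIV_option del: One_nat_def)
  have w: "?w $ l \<ge> 0" "?w $ l \<le> 1" for l
    using assms(1,2) by (auto simp: lift_map_all_ones split: sum.splits)
  show "?w $ l \<ge> 0" for l by (rule w)
  have N: "psum 1 ?w \<ge> 3"
    using assms(3) unfolding psum_lift_map power_one_right sum_affine_powers
    by (simp add: mean_all_ones total_weight_def algebra_simps)
  show "psum 1 ?w - ?w $ l > 0" for l
    using N w(2)[of l] by linarith
  show "psum 1 ?w - ?w $ l - ?w $ m > 0" for l m
    using N w(2)[of l] w(2)[of m] by linarith
qed

text \<open>On a line in direction \<open>all_ones\<close> through a vector of mean 0, the mean is
  the parameter and the central moments are constant. The restriction is therefore a depressed
  cubic, and one test vector gives the bound on \<open>B\<close> and \<open>C\<close>.\<close>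

lemma symmetric_hyperbolic_cubic:
  fixes p :: "('n::finite, real) mpoly"
  assumes "symmetric_hyperbolic p" and "total_degree p = 3"
  obtains A B C where "A \<noteq> 0" "B \<le> 0"
    "4 * B ^ 3 * real CARD('n) * (real CARD('n) - 1) + 27 * C\<^sup>2 * (real CARD('n) - 2)\<^sup>2 \<le> 0"
    "real CARD('n) \<ge> 3 \<or> C = 0"
    "\<And>x. mpoly_eval p x = A * (mean x ^ 3 + B * mean x * cmoment 2 x + C * cmoment 3 x)"
proof -
  define n where "n = real CARD('n)"
  have n1: "n \<ge> 1" by (simp add: n_def Suc_le_eq)
  have hyp: "hyperbolic p all_ones" and "sym_cubic (mpoly_eval p)"
    using assms by (auto simp: symmetric_hyperbolic_def hyperbolic_def intro: sym_cubic_mpoly_eval)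
  then obtain a b c where
    abc: "\<And>x. mpoly_eval p x = a * psum 1 x ^ 3 + b * (psum 1 x * psum 2 x) + c * psum 3 x"
    unfolding sym_cubic_def by blast
  define A where "A = a * n ^ 3 + b * n\<^sup>2 + c * n"
  define B where "B = (b * n + 3 * c) / A"
  define C where "C = c / A"
  have eval: "mpoly_eval p x = A * mean x ^ 3 + (b * n + 3 * c) * mean x * cmoment 2 x + c * cmoment 3 x" for x
    unfolding abc psum_eq_cmoments A_def n_def[symmetric]
    by (simp add: power2_eq_square power3_eq_cube algebra_simps)
  \<comment> \<open>\<open>A\<close> is the value at \<open>all_ones\<close>, nonzero by
    hyperbolicity.\<close>
  have "cmoment 2 (all_ones :: real ^ 'n) = 0" "cmoment 3 (all_ones :: real ^ 'n) = 0"
    by (simp_all add: cmoment_def mean_all_ones) (simp_all add: all_ones_def)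
  then have A: "A \<noteq> 0"
    using hyp eval[of all_ones] by (simp add: hyperbolic_def mean_all_ones)
  have eval': "mpoly_eval p x = A * (mean x ^ 3 + B * mean x * cmoment 2 x + C * cmoment 3 x)" for x
    using A by (simp add: eval B_def C_def distrib_left)
  have line: "only_real_roots (Polynomial.smult A [:C * cmoment 3 x, B * cmoment 2 x, 0, 1:])"
    if x: "mean x = 0" for x :: "real ^ 'n"
  proof -
    have "poly (line_poly p x all_ones) = poly (Polynomial.smult A [:C * cmoment 3 x, B * cmoment 2 x, 0, 1:])"
    proof
      fix t
      have m: "mean (x + t *\<^sub>R all_ones) = t"
        by (simp add: linear_add[OF linear_mean] linear_scale[OF linear_mean] mean_all_ones x)
      then have "cmoment j (x + t *\<^sub>R all_ones) = cmoment j x" for j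
        by (simp add: cmoment_def x) (simp add: all_ones_def)
      then show "poly (line_poly p x all_ones) t = poly (Polynomial.smult A [:C * cmoment 3 x, B * cmoment 2 x, 0, 1:]) t"
        by (simp add: poly_line_poly eval' m power3_eq_cube algebra_simps)
    qed
    then show ?thesis
      using hyp by (metis hyperbolic_def poly_eq_poly_eq_iff)
  qed
  obtain i :: 'n where True by simp
  \<comment> \<open>The mean-zero vector with one entry \<open>n - 1\<close> and all others -1; its
    moments match the terms of e_3 at \<open>v = 0\<close>, so the resulting bound is the one needed
    for \<open>g 0\<close>.\<close>
  define x :: "real ^ 'n" where "x = (\<chi> j. if j = i then n - 1 else -1)"
  have powers: "(\<Sum>j\<in>UNIV. (x $ j) ^ m) = (n - 1) ^ m + (n - 1) * (-1) ^ m" for m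
  proof -
    have "(\<Sum>j\<in>UNIV. (x $ j) ^ m) = (\<Sum>j\<in>UNIV. (if j = i then (n - 1) ^ m - (-1) ^ m else 0) + (-1) ^ m)"
      by (intro sum.cong) (auto simp: x_def)
    then show ?thesis
      by (simp add: sum.distrib n_def algebra_simps)
  qed
  have m: "mean x = 0"
    using powers[of 1] by (simp add: mean_def psum_def)
  have q: "cmoment 2 x = n * (n - 1)" and r: "cmoment 3 x = n * (n - 1) * (n - 2)"
    using powers[of 2] powers[of 3] m
    by (simp_all add: cmoment_def power2_eq_square power3_eq_cube algebra_simps)
  have B: "B * (n * (n - 1)) \<le> 0"
    and disc: "4 * (B * (n * (n - 1))) ^ 3 + 27 * (C * (n * (n - 1) * (n - 2)))\<^sup>2 \<le> 0"
    using only_real_roots_depressed_cubic[OF line[OF m] A] unfolding q r by simp_all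
  have zero: "cmoment 3 y = 0" if "n < 3" for y :: "real ^ 'n"
    unfolding cmoment_def
    using that cmoment_1[of y] by (intro finite_card_le_2_sum_cube_zero) (simp_all add: n_def cmoment_def)
  have "CARD('n) = 1 \<or> CARD('n) = 2 \<or> CARD('n) \<ge> 3"
    using zero_less_card_finite[where ?'a = 'n] by linarith
  then consider "n = 1" | "n = 2" | "n \<ge> 3"
    unfolding n_def by fastforce
  then show ?thesis
  proof cases
    case 1
    \<comment> \<open>For one variable the test vector is 0 and says nothing about \<open>B\<close>;
      as both moments vanish, \<open>B = C = 0\<close> can be chosen.\<close>
    have "cmoment 2 y = 0" for y :: "real ^ 'n"
    proof -
      obtain i :: 'n where i: "UNIV = {i}"
        using 1 by (auto simp: n_def card_1_singleton_iff)
      show ?thesis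
        using cmoment_1[of y] unfolding cmoment_def i by simp
    qed
    then show ?thesis
      using A zero 1 that[of A 0 0] by (simp add: eval')
  next
    case 2
    then show ?thesis
      using A B zero that[of A B 0] disc by (simp add: eval' n_def[symmetric])
  next
    case 3
    then have nn: "n * (n - 1) > 0" by simp
    \<comment> \<open>The moments of the test vector contribute a common factor
      \<open>(n * (n - 1))^2\<close>, positive in this case.\<close>
    have "(n * (n - 1))\<^sup>2 * (4 * B ^ 3 * n * (n - 1) + 27 * C\<^sup>2 * (n - 2)\<^sup>2) \<le> 0"
      using disc by (simp add: power2_eq_square power3_eq_cube algebra_simps)
    then have "4 * B ^ 3 * n * (n - 1) + 27 * C\<^sup>2 * (n - 2)\<^sup>2 \<le> 0"
      using nn by (auto simp: mult_le_0_iff)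
    moreover have "B \<le> 0" using B 3 nn by (simp add: mult_le_0_iff)
    ultimately show ?thesis
      using A 3 eval' that[of A B C] by (simp add: n_def)
  qed
qed

theorem corollary1p14:
  fixes p :: "('n::finite, real) mpoly"
  assumes "symmetric_hyperbolic p"
    and "total_degree p = 3"
  shows "spectrahedral (hyperbolicity_cone p all_ones)"
proof -
  let ?n = "real CARD('n)"
  obtain A B C where A: "A \<noteq> 0" and B: "B \<le> 0"
    and disc: "4 * B ^ 3 * ?n * (?n - 1) + 27 * C\<^sup>2 * (?n - 2)\<^sup>2 \<le> 0" and C: "?n \<ge> 3 \<or> C = 0"
    and eval: "\<And>x. mpoly_eval p x = A * (mean x ^ 3 + B * mean x * cmoment 2 x + C * cmoment 3 x)"
    using symmetric_hyperbolic_cubic[OF assms] by blast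
  have "?n \<ge> 1" by (simp add: Suc_le_eq)
  from lift_parameters_exist[OF this B disc C] obtain v k where
    v: "0 \<le> v" "v \<le> 1" "total_weight ?n v \<ge> 3" and L: "cube_coeff ?n v > 0"
    and BC: "cube_coeff ?n v * B = - square_coeff ?n v * k\<^sup>2"
      "cube_coeff ?n v * C = (1 - v ^ 3) / 3 * k ^ 3" .
  have "esym3 (lift_map v k x) = cube_coeff ?n v * mean x ^ 3
      + cube_coeff ?n v * B * mean x * cmoment 2 x + cube_coeff ?n v * C * cmoment 3 x" for x :: "real ^ 'n"
    unfolding esym3_lift_map BC by simp
  then have "esym3 (lift_map v k x) = cube_coeff ?n v / A * mpoly_eval p x" for x :: "real ^ 'n"
    using A by (simp add: eval algebra_simps)
  \<comment> \<open>The pullback of e_3 and \<open>p\<close> differ by a nonzero constant, so they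
    have the same zeros on every ray in direction \<open>all_ones\<close>.\<close>
  then have "hyperbolicity_cone p all_ones =
      {x. \<forall>t>0. esym3 (lift_map v k (x + t *\<^sub>R all_ones)) \<noteq> 0}"
    using A L by (simp add: hyperbolicity_cone_def)
  then show ?thesis
    using spectrahedral_lift_cone[OF v] by simp
qed

end
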